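(* For the CLTSP restricted to instances with zero processing times ($\tau(a)=0$ for all $a$), only deadlines ($r(a)=0$ for all $a$) and slow clients ($0<v<1$), there is an algorithm (a dynamic program) that in $O(n^2)$ time either correctly reports that the instance is infeasible or returns the minimum makespan of a feasible solution.
   Context: An instance of the line traveling salesman problem with collaboration (CLTSP) consists of a finite set $A$ of clients, $n=|A|$, a client speed $v>0$, and for each client $a\in A$ a starting position $s(a)\in\mathbb{R}$, a release date $r(a)\in\mathbb{R}_{\ge 0}$, a deadline $d(a)\in\mathbb{R}_{\ge0}\cup\{\infty\}$ and a processing time $\tau(a)\in\mathbb{R}_{\ge0}$. A single server starts at time $0$ at position $0$ and moves along the real line with speed at most $1$ (it may wait). Client $a$ is at position $s(a)$ at time $r(a)$ and from then on can move along the line with speed at most $v$ (or wait). A solution is a pair $(t,x)$ of maps $t:A\to\mathbb{R}_{\ge0}$, $x:A\to\mathbb{R}$, where $(t(a),x(a))$ is the time and position of the rendezvous of the server with client $a$. Let $\sigma_1,\dots,\sigma_n$ be the clients ordered by rendezvous time, put $(t_i,x_i)=(t(\sigma_i),x(\sigma_i))$ for $1\le i\le n$, $(t_0,x_0)=(0,0)$, and let $(t_{n+1},x_{n+1})$ be the time and position at which the server ends. Completion times are $c_0=0$, $c_i=t_i+\tau(\sigma_i)$ for $1\le i\le n$, $c_{n+1}=t_{n+1}$. The solution is feasible if $x_{n+1}=0$; $t_i\ge c_{i-1}+|x_i-x_{i-1}|$ for all $1\le i\le n+1$; $t(a)\ge r(a)+|x(a)-s(a)|/v$ for all $a\in A$;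 and $r(a)\le t(a)\le d(a)$ for all $a$. The makespan is $C_{\max}(t,x)=c_{n+1}$; the CLTSP asks for a feasible solution of minimum makespan; an instance is infeasible if it has no feasible solution. *)

theory Defs
  imports Complex_Main "HOL-Library.Extended_Real" "HOL-Library.Landau_Symbols"
begin

section \<open>The line travelling salesman problem with collaboration\<close>

record 'a cltsp =
  clients  :: "'a set"
  speed    :: real
  start    :: "'a \<Rightarrow> real"
  release  :: "'a \<Rightarrow> real"
  deadline :: "'a \<Rightarrow> ereal"
  proctime :: "'a \<Rightarrow> real"

definition cltsp_instance :: "'a cltsp \<Rightarrow> bool" where
  "cltsp_instance I \<longleftrightarrow>
     finite (clients I) \<and> 0 < speed I \<and>
     (\<forall>a\<in>clients I. 0 \<le> release I a \<and> 0 \<le> deadline I a \<and> 0 \<le> proctime I a)"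

text \<open>
  A solution consists of the time and the position of each rendezvous, together with the time and
  the position at which the server ends.
\<close>

record 'a solution =
  rtime    :: "'a \<Rightarrow> real"
  rpos     :: "'a \<Rightarrow> real"
  end_time :: real
  end_pos  :: real

text \<open>
  The list \<open>\<sigma>\<close> is an ordering of the clients; its element \<open>\<sigma> ! (i - 1)\<close> is the \<open>i\<close>-th client
  served. Index \<open>0\<close> stands for the start of the server and every index beyond \<open>length \<sigma>\<close> for
  its end.
\<close>

definition stop_time :: "'a solution \<Rightarrow> 'a list \<Rightarrow> nat \<Rightarrow> real" where
  "stop_time S \<sigma> i =
     (if i = 0 then 0 else if i \<le> length \<sigma> then rtime S (\<sigma> ! (i - 1)) else end_time S)"

definition stop_pos :: "'a solution \<Rightarrow> 'a list \<Rightarrow> nat \<Rightarrow> real" where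
  "stop_pos S \<sigma> i =
     (if i = 0 then 0 else if i \<le> length \<sigma> then rpos S (\<sigma> ! (i - 1)) else end_pos S)"

definition completion :: "'a cltsp \<Rightarrow> 'a solution \<Rightarrow> 'a list \<Rightarrow> nat \<Rightarrow> real" where
  "completion I S \<sigma> i =
     (if i = 0 then 0
      else if i \<le> length \<sigma> then stop_time S \<sigma> i + proctime I (\<sigma> ! (i - 1))
      else stop_time S \<sigma> i)"

text \<open>
  Clients with equal rendezvous times may be put in any order, so feasibility asks for some
  ordering by rendezvous time that the server can follow.
\<close>

definition feasible :: "'a cltsp \<Rightarrow> 'a solution \<Rightarrow> bool" where
  "feasible I S \<longleftrightarrow>
     (\<exists>\<sigma>. distinct \<sigma> \<and> set \<sigma> = clients I \<and> sorted (map (rtime S) \<sigma>) \<and>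
        (\<forall>i\<in>{1..card (clients I) + 1}.
           stop_time S \<sigma> i \<ge>
             completion I S \<sigma> (i - 1) + \<bar>stop_pos S \<sigma> i - stop_pos S \<sigma> (i - 1)\<bar>)) \<and>
     end_pos S = 0 \<and>
     (\<forall>a\<in>clients I.
        0 \<le> rtime S a \<and>
        rtime S a \<ge> release I a + \<bar>rpos S a - start I a\<bar> / speed I \<and>
        release I a \<le> rtime S a \<and> ereal (rtime S a) \<le> deadline I a)"

definition makespan :: "'a solution \<Rightarrow> real" where
  "makespan S = end_time S"

definition min_makespan :: "'a cltsp \<Rightarrow> real \<Rightarrow> bool" where
  "min_makespan I C \<longleftrightarrow>
     (\<exists>S. feasible I S \<and> makespan S = C) \<and> (\<forall>S. feasible I S \<longrightarrow> C \<le> makespan S)"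


section \<open>Real RAM programs and their running time\<close>

text \<open>
  A real RAM in the form of a while language. The memory consists of arrays of natural numbers
  and arrays of reals. Array names are literals, so that a program uses only finitely many arrays,
  and array indices are computed at run time (indirect addressing). A scalar is kept in cell
  \<open>0\<close> of an array. Every elementary operation costs one time unit. On natural numbers only
  addition and truncated subtraction are available; on reals the four arithmetic operations and
  comparison. Reals cannot be converted to natural numbers, there is no floor function, and real
  constants are rational.
\<close>

record mem =
  nmem :: "string \<Rightarrow> nat \<Rightarrow> nat"
  rmem :: "string \<Rightarrow> nat \<Rightarrow> real"

datatype nexp =
    NConst nat
  | NCell string nexp
  | NAdd nexp nexp
  | NSub nexp nexp

datatype rexp =
    RConst rat
  | RCell string nexp
  | RAdd rexp rexp
  | RSub rexp rexp
  | RMul rexp rexp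
  | RDiv rexp rexp

datatype bexp =
    NLess nexp nexp
  | RLess rexp rexp
  | BNot bexp
  | BAnd bexp bexp

datatype com =
    Skip
  | NAssign string nexp nexp
  | RAssign string nexp rexp
  | Seq com com
  | Cond bexp com com
  | Loop bexp com

fun nval :: "nexp \<Rightarrow> mem \<Rightarrow> nat" where
  "nval (NConst k) m = k"
| "nval (NCell x e) m = nmem m x (nval e m)"
| "nval (NAdd e f) m = nval e m + nval f m"
| "nval (NSub e f) m = nval e m - nval f m"

text \<open>
  Division by zero yields \<open>0\<close>; this adds no power, since a program can test for a zero divisor.
\<close>

fun rval :: "rexp \<Rightarrow> mem \<Rightarrow> real" where
  "rval (RConst q) m = of_rat q"
| "rval (RCell x e) m = rmem m x (nval e m)"
| "rval (RAdd e f) m = rval e m + rval f m"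
| "rval (RSub e f) m = rval e m - rval f m"
| "rval (RMul e f) m = rval e m * rval f m"
| "rval (RDiv e f) m = rval e m / rval f m"

fun bval :: "bexp \<Rightarrow> mem \<Rightarrow> bool" where
  "bval (NLess e f) m \<longleftrightarrow> nval e m < nval f m"
| "bval (RLess e f) m \<longleftrightarrow> rval e m < rval f m"
| "bval (BNot b) m \<longleftrightarrow> \<not> bval b m"
| "bval (BAnd b c) m \<longleftrightarrow> bval b m \<and> bval c m"

fun ncost :: "nexp \<Rightarrow> nat" where
  "ncost (NConst k) = 1"
| "ncost (NCell x e) = ncost e + 1"
| "ncost (NAdd e f) = ncost e + ncost f + 1"
| "ncost (NSub e f) = ncost e + ncost f + 1"

fun rcost :: "rexp \<Rightarrow> nat" where
  "rcost (RConst q) = 1"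
| "rcost (RCell x e) = ncost e + 1"
| "rcost (RAdd e f) = rcost e + rcost f + 1"
| "rcost (RSub e f) = rcost e + rcost f + 1"
| "rcost (RMul e f) = rcost e + rcost f + 1"
| "rcost (RDiv e f) = rcost e + rcost f + 1"

fun bcost :: "bexp \<Rightarrow> nat" where
  "bcost (NLess e f) = ncost e + ncost f + 1"
| "bcost (RLess e f) = rcost e + rcost f + 1"
| "bcost (BNot b) = bcost b + 1"
| "bcost (BAnd b c) = bcost b + bcost c + 1"

text \<open>
  \<open>exec c m k m'\<close>: started in memory \<open>m\<close>, the program \<open>c\<close> terminates after exactly \<open>k\<close> time
  units in memory \<open>m'\<close>.
\<close>

inductive exec :: "com \<Rightarrow> mem \<Rightarrow> nat \<Rightarrow> mem \<Rightarrow> bool" where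
  Skip: "exec Skip m 1 m"
| NAssign: "exec (NAssign x i e) m (ncost i + ncost e + 1)
    (m\<lparr>nmem := (nmem m)(x := (nmem m x)(nval i m := nval e m))\<rparr>)"
| RAssign: "exec (RAssign x i e) m (ncost i + rcost e + 1)
    (m\<lparr>rmem := (rmem m)(x := (rmem m x)(nval i m := rval e m))\<rparr>)"
| Seq: "\<lbrakk>exec c1 m k1 m1; exec c2 m1 k2 m2\<rbrakk> \<Longrightarrow> exec (Seq c1 c2) m (k1 + k2) m2"
| CondTrue: "\<lbrakk>bval b m; exec c1 m k m'\<rbrakk> \<Longrightarrow> exec (Cond b c1 c2) m (bcost b + k + 1) m'"
| CondFalse: "\<lbrakk>\<not> bval b m; exec c2 m k m'\<rbrakk> \<Longrightarrow> exec (Cond b c1 c2) m (bcost b + k + 1) m'"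
| LoopFalse: "\<not> bval b m \<Longrightarrow> exec (Loop b c) m (bcost b + 1) m"
| LoopTrue: "\<lbrakk>bval b m; exec c m k1 m1; exec (Loop b c) m1 k2 m2\<rbrakk>
    \<Longrightarrow> exec (Loop b c) m (bcost b + k1 + k2 + 1) m2"

inductive_cases exec_SkipE: "exec Skip m k m'"
inductive_cases exec_NAssignE: "exec (NAssign x i e) m k m'"
inductive_cases exec_RAssignE: "exec (RAssign x i e) m k m'"
inductive_cases exec_SeqE: "exec (Seq c1 c2) m k m'"
inductive_cases exec_CondE: "exec (Cond b c1 c2) m k m'"
inductive_cases exec_LoopE: "exec (Loop b c) m k m'"

lemma exec_deterministic:
  "exec c m k m' \<Longrightarrow> exec c m l m'' \<Longrightarrow> l = k \<and> m'' = m'"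
proof (induction arbitrary: l m'' rule: exec.induct)
  case (Skip m)
  from Skip.prems show ?case by (rule exec_SkipE) simp
next
  case (NAssign x i e m)
  from NAssign.prems show ?case by (rule exec_NAssignE) simp
next
  case (RAssign x i e m)
  from RAssign.prems show ?case by (rule exec_RAssignE) simp
next
  case (Seq c1 m k1 m1 c2 k2 m2)
  from Seq.prems obtain l1 n1 l2 where
    "exec c1 m l1 n1" "exec c2 n1 l2 m''" "l = l1 + l2"
    by (rule exec_SeqE)
  with Seq.IH show ?case by metis
next
  case (CondTrue b m c1 k m' c2)
  from CondTrue.prems obtain l1 where
    "exec c1 m l1 m''" "l = bcost b + l1 + 1"
    by (rule exec_CondE) (use CondTrue.hyps(1) in simp_all)
  with CondTrue.IH show ?case by metis
next
  case (CondFalse b m c2 k m' c1)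
  from CondFalse.prems obtain l1 where
    "exec c2 m l1 m''" "l = bcost b + l1 + 1"
    by (rule exec_CondE) (use CondFalse.hyps(1) in simp_all)
  with CondFalse.IH show ?case by metis
next
  case (LoopFalse b m c)
  from LoopFalse.prems show ?case by (rule exec_LoopE) (use LoopFalse.hyps in simp_all)
next
  case (LoopTrue b m c k1 m1 k2 m2)
  from LoopTrue.prems obtain l1 n1 l2 where
    "exec c m l1 n1" "exec (Loop b c) n1 l2 m''" "l = bcost b + l1 + l2 + 1"
    by (rule exec_LoopE) (use LoopTrue.hyps(1) in simp_all)
  with LoopTrue.IH show ?case by metis
qed


section \<open>Solving the problem on a real RAM\<close>

text \<open>
  The input lists the clients in an arbitrary order \<open>as\<close>. An infinite deadline is marked by \<open>1\<close>
  in the array \<open>''inf''\<close> (\<open>real_of_ereal \<infinity>\<close> is \<open>0\<close>). All other cells initially contain \<open>0\<close>.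
\<close>

definition list_array :: "('a \<Rightarrow> 'b::zero) \<Rightarrow> 'a list \<Rightarrow> nat \<Rightarrow> 'b" where
  "list_array f as i = (if i < length as then f (as ! i) else 0)"

definition input_mem :: "'a cltsp \<Rightarrow> 'a list \<Rightarrow> mem" where
  "input_mem I as =
     \<lparr>nmem = (\<lambda>_ _. 0)
        (''n''   := (\<lambda>_. 0)(0 := length as),
         ''inf'' := list_array (\<lambda>a. if deadline I a = \<infinity> then 1 else 0) as),
      rmem = (\<lambda>_ _. 0)
        (''v''   := (\<lambda>_. 0)(0 := speed I),
         ''s''   := list_array (start I) as,
         ''r''   := list_array (release I) as,
         ''d''   := list_array (\<lambda>a. real_of_ereal (deadline I a)) as,
         ''tau'' := list_array (proctime I) as)\<rparr>"

text \<open>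
  The answer \<open>None\<close> reports infeasibility, \<open>Some C\<close> returns \<open>C\<close>.
\<close>

definition result :: "mem \<Rightarrow> real option" where
  "result m = (if nmem m ''feasible'' 0 = 0 then None else Some (rmem m ''makespan'' 0))"

definition correct_answer :: "'a cltsp \<Rightarrow> real option \<Rightarrow> bool" where
  "correct_answer I ans \<longleftrightarrow>
     (case ans of None \<Rightarrow> (\<nexists>S. feasible I S) | Some C \<Rightarrow> min_makespan I C)"

text \<open>
  The program \<open>P\<close> solves every instance of the class \<open>\<C>\<close> with \<open>n\<close> clients within \<open>T n\<close> time
  units. Finite client sets can be labelled by natural numbers, so client type \<^typ>\<open>nat\<close> is no
  restriction, and it keeps \<open>P\<close> independent of the type of the clients.
\<close>

definition solves_within :: "com \<Rightarrow> (nat cltsp \<Rightarrow> bool) \<Rightarrow> (nat \<Rightarrow> nat) \<Rightarrow> bool" where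
  "solves_within P \<C> T \<longleftrightarrow>
     (\<forall>I as. cltsp_instance I \<and> \<C> I \<and> distinct as \<and> set as = clients I \<longrightarrow>
        (\<exists>k m. exec P (input_mem I as) k m \<and> k \<le> T (card (clients I)) \<and>
               correct_answer I (result m)))"

end

theory Submission imports Defs begin

text \<open>
  Write \<open>z(t)\<close> for the position of the server. A client starting at \<open>s \<ge> 0\<close> can be
  met by time \<open>t\<close> iff \<open>z(t') + v t'\<close> has reached \<open>s\<close> for some
  \<open>t' \<le> t\<close>, and symmetrically on the left. So the clients of either side are met from the
  inside out, and a state of the search is a pair \<open>(i, j)\<close> counting the clients met on the right
  and on the left, together with the side on which the last one was met; that client has walked a distance
  \<open>v t\<close> from its start, so the state determines the position at time \<open>t\<close>. As
  \<open>v < 1\<close>, being in the same state earlier is never worse, so only the earliest arrival time in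
  each of the \<open>O(n\<^sup>2)\<close> states matters.
\<close>

section \<open>Earliest arrivals\<close>

text \<open>The clients' reaches are bounded by the moving lines \<open>X - v * t\<close> and
  \<open>- (Y - v * t)\<close>. Being slower than the server, such a line stays inside the cone of
  points reachable from any of its own points, so an earlier arrival on it dominates a later one
  (\<open>cone_mono\<close>). The obstacle is that a feasible solution may meet clients in any
  order, possibly long after entering their reach, and only its stops are given. So it is compared
  at the stops alone: if a stop lies beyond a line and in the cone of a state, it is still in the
  cone of the point where a straight run from that state hits the line
  (\<open>cone_meets_line\<close>). The crossing is thus backdated, and a client not yet met still
  has its deadline ahead. Both counters run over all \<open>n\<close> clients; those starting on the
  other side have threshold 0 and can be passed at time 0. The two candidates in
  \<open>relax\<close> are such straight runs at unit speed: from \<open>X - v * p\<close> at time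
  \<open>p\<close> to \<open>X + g - v * b\<close>, and from \<open>v * q - Y\<close> at time
  \<open>q\<close> to \<open>X' - v * b\<close> with \<open>h = X' + Y\<close>, both solved for
  \<open>b\<close>.\<close>

text \<open>
  The value \<open>-1\<close> stands for an unreachable state. In a step to the next threshold, \<open>p\<close> and
  \<open>q\<close> are the arrival times at the previous threshold on the same side and at the current one on the other
  side, \<open>g\<close> and \<open>h\<close> the distances between the starting positions involved.
\<close>

definition relax :: "real \<Rightarrow> (real \<Rightarrow> bool) \<Rightarrow> real \<Rightarrow> real \<Rightarrow> real \<Rightarrow> real \<Rightarrow> real" where
  "relax v ok p q g h =
     (let c = (if p < 0 then -1 else p + g / (1 + v));
          b = (h + (1 - v) * q) / (1 + v);
          c' = (if \<not> q < 0 \<and> (c < 0 \<or> b < c) then b else c)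
      in if \<not> c' < 0 \<and> ok c' then c' else -1)"

text \<open>
  The earliest time at which the server stands on threshold \<open>x i\<close> with \<open>j\<close> thresholds passed on
  the other side; the mirror image, with \<open>x\<close> and \<open>y\<close> exchanged, covers the other side.
\<close>

function arrive :: "real \<Rightarrow> (nat \<Rightarrow> real) \<Rightarrow> (nat \<Rightarrow> real) \<Rightarrow> (nat \<Rightarrow> real \<Rightarrow> bool) \<Rightarrow>
    (nat \<Rightarrow> real \<Rightarrow> bool) \<Rightarrow> nat \<Rightarrow> nat \<Rightarrow> real" where
  "arrive v x y P Q 0 j = (if j = 0 then 0 else -1)"
| "arrive v x y P Q (Suc i) j =
     relax v (P (Suc i)) (arrive v x y P Q i j) (arrive v y x Q P j i)
       (x (Suc i) - x i) (x (Suc i) + y j)"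
  by pat_completeness auto
termination by (relation "measure (\<lambda>(v, x, y, P, Q, i, j). i + j)") auto

text \<open>The last client is met at distance \<open>\<bar>X - v * a\<bar>\<close> from the origin,
  on the left correspondingly, so each sum is an arrival time plus the way home.\<close>

definition best_return :: "real \<Rightarrow> real \<Rightarrow> real \<Rightarrow> real \<Rightarrow> real \<Rightarrow> real option" where
  "best_return v a X b Y =
     (if a < 0 then if b < 0 then None else Some (b + \<bar>Y - v * b\<bar>)
      else if b < 0 then Some (a + \<bar>X - v * a\<bar>)
      else Some (min (a + \<bar>X - v * a\<bar>) (b + \<bar>Y - v * b\<bar>)))"

lemma relax_cases:
  assumes "0 \<le> relax v ok p q g h"
  shows "ok (relax v ok p q g h)"
    and "(0 \<le> p \<and> relax v ok p q g h = p + g / (1 + v)) \<or>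
         (0 \<le> q \<and> relax v ok p q g h = (h + (1 - v) * q) / (1 + v))"
  using assms by (auto simp: relax_def Let_def split: if_splits)

text \<open>\<open>relax\<close> picks the smaller candidate before testing the deadline; nothing is
  lost because \<open>ok\<close> holds at every time up to \<open>b\<close>.\<close>

lemma relax_le:
  assumes ok: "ok b" "\<And>c. c \<le> b \<Longrightarrow> ok c" and "0 \<le> b" "0 \<le> v" "v < 1" "0 \<le> g" "0 \<le> h"
    and b: "0 \<le> p \<and> b = p + g / (1 + v) \<or> 0 \<le> q \<and> b = (h + (1 - v) * q) / (1 + v)"
  shows "0 \<le> relax v ok p q g h" "relax v ok p q g h \<le> b"
proof -
  have "0 \<le> p \<Longrightarrow> 0 \<le> p + g / (1 + v)" "0 \<le> q \<Longrightarrow> 0 \<le> (h + (1 - v) * q) / (1 + v)"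
    using assms by auto
  then show "0 \<le> relax v ok p q g h" "relax v ok p q g h \<le> b"
    using b ok(2) \<open>0 \<le> b\<close> unfolding relax_def Let_def
    by (smt (verit))+
qed

section \<open>Cones of reachable points and moving threshold lines\<close>

lemma scaled_difference_le: "0 < v \<Longrightarrow> v < 1 \<Longrightarrow> a \<le> b \<Longrightarrow> v * (b - a) \<le> b - (a::real)"
  by (simp add: mult_left_le_one_le)

text \<open>The run to the right from \<open>p\<close> at time \<open>c\<close> hits the line
  \<open>X - v * t\<close> at time \<open>b\<close>, so the cones at both points share their right
  boundary. On the left the line itself is the barrier, and with \<open>v < 1\<close> it lies inside
  the new cone.\<close>

lemma cone_meets_line:
  fixes t :: real
  assumes v: "0 < v" "v < 1" and cone: "c + \<bar>z - p\<bar> \<le> t" and u: "X \<le> z + v * t"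
    and b: "b = (X - p + c) / (1 + v)"
  shows "b + \<bar>z - (X - v * b)\<bar> \<le> t"
proof -
  have e: "b + v * b = X - p + c"
  proof -
    have "b * (1 + v) = X - p + c" using v unfolding b by simp
    then show ?thesis by (simp add: algebra_simps)
  qed
  have "(1 + v) * b \<le> (1 + v) * t"
    using e cone u v by (simp add: algebra_simps)
  then have bt: "b \<le> t" using v by simp
  have "v * t - v * b \<le> t - b"
    using scaled_difference_le[OF v bt] by (simp add: algebra_simps)
  then have "z - (X - v * b) \<le> t - b" "- (z - (X - v * b)) \<le> t - b"
    using e u abs_le_D1[of "z - p" "t - c"] cone bt by linarith+
  then show ?thesis by (simp add: abs_le_iff)
qed

text \<open>A server on the line at time \<open>a\<close> can follow it until \<open>b\<close>, as
  the line moves more slowly than the server.\<close>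

lemma cone_mono:
  fixes t :: real
  assumes "0 < v" "v < 1" "b + \<bar>z - (X - v * b)\<bar> \<le> t" "a \<le> b"
  shows "a + \<bar>z - (X - v * a)\<bar> \<le> t"
proof -
  have "v * b - v * a \<le> b - a" "0 \<le> v * b - v * a"
    using scaled_difference_le[OF assms(1,2,4)] assms by (auto simp: algebra_simps)
  then show ?thesis using assms(3,4) by (simp add: abs_le_iff)
qed

text \<open>\<open>2 * v * c \<le> X + Y\<close> says that the lines \<open>X - v * t\<close> and
  \<open>v * t - Y\<close> have not crossed before time \<open>c\<close>; \<open>Z\<close> is the
  gap to the next threshold. A run on the same side preserves this since
  \<open>2 * v \<le> 1 + v\<close>; after a change of sides, \<open>(1 + v) * (2 * v * b)\<close>
  weighs \<open>X + Y + Z\<close> and \<open>2 * v * c\<close> by \<open>2 * v\<close> and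
  \<open>1 - v\<close>, which add up to \<open>1 + v\<close>.\<close>

lemma arrival_later:
  fixes v :: real
  assumes v: "0 < v" "v < 1" and c: "2 * v * c \<le> X + Y" and Z: "0 \<le> Z"
    and b: "b = c + Z / (1 + v) \<or> b = (X + Y + Z + (1 - v) * c) / (1 + v)"
  shows "c \<le> b" "2 * v * b \<le> X + Y + Z"
proof -
  from b have "c \<le> b \<and> 2 * v * b \<le> X + Y + Z"
  proof
    assume b: "b = c + Z / (1 + v)"
    have "2 * v * (Z / (1 + v)) \<le> Z"
      using v Z by (simp add: field_simps) (metis less_eq_real_def mult_left_le mult_2_right add_mono mult.commute add.commute)
    then show ?thesis using b v c Z by (simp add: algebra_simps)
  next
    assume b: "b = (X + Y + Z + (1 - v) * c) / (1 + v)"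
    then have e: "b * (1 + v) = X + Y + Z + (1 - v) * c" using v by (simp add: field_simps)
    have "c * (1 + v) \<le> b * (1 + v)" using e c Z by (simp add: algebra_simps)
    moreover have "2 * v * b * (1 + v) \<le> (X + Y + Z) * (1 + v)"
    proof -
      have "2 * v * b * (1 + v) = 2 * v * (X + Y + Z) + (1 - v) * (2 * v * c)"
        using arg_cong[OF e, of "\<lambda>z. 2 * v * z"] by (simp add: algebra_simps)
      also have "\<dots> \<le> 2 * v * (X + Y + Z) + (1 - v) * (X + Y + Z)"
        using c v Z by (intro add_left_mono mult_left_mono) auto
      finally show ?thesis by (simp add: algebra_simps)
    qed
    ultimately show ?thesis using v by simp
  qed
  then show "c \<le> b" "2 * v * b \<le> X + Y + Z" by auto
qed

lemma scaled_eq: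
  fixes v :: real
  assumes "0 < v"
  shows "b = w / (1 + v) \<Longrightarrow> b + v * b = w" "b = p + g / (1 + v) \<Longrightarrow> b + v * b = p + v * p + g"
  using assms by (simp_all add: field_simps)

lemma collect_Suc:
  "{f k |k. 1 \<le> k \<and> k \<le> Suc j \<and> p k} =
     {f k |k. 1 \<le> k \<and> k \<le> j \<and> p k} \<union> (if p (Suc j) then {f (Suc j)} else {})"
  by (auto simp: le_Suc_eq)

text \<open>With zero release dates and processing times a rendezvous is a condition on the current
  point alone: the client can be anywhere within \<open>speed I * t\<close> of its start. This keeps
  orderings and solution records out of the analysis of the table.\<close>

inductive served :: "'a cltsp \<Rightarrow> 'a set \<Rightarrow> real \<Rightarrow> real \<Rightarrow> bool" for I where
  init: "served I {} 0 0"
| move: "served I V t x \<Longrightarrow> \<bar>x' - x\<bar> \<le> t' - t \<Longrightarrow> served I V t' x'"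
| meet: "served I V t x \<Longrightarrow> a \<in> clients I \<Longrightarrow> \<bar>x - start I a\<bar> \<le> speed I * t \<Longrightarrow>
    ereal t \<le> deadline I a \<Longrightarrow> served I (insert a V) t x"

section \<open>From partial schedules to feasible solutions\<close>

locale plain_cltsp =
  fixes I :: "'a cltsp"
  assumes inst: "cltsp_instance I"
    and proc: "\<And>a. a \<in> clients I \<Longrightarrow> proctime I a = 0"
    and rel: "\<And>a. a \<in> clients I \<Longrightarrow> release I a = 0"
    and slow: "speed I < 1"
begin

lemma speed_pos: "0 < speed I"
  and deadline_nonneg: "a \<in> clients I \<Longrightarrow> 0 \<le> deadline I a"
  using inst by (auto simp: cltsp_instance_def)

lemma completion_eq:
  "set \<sigma> \<subseteq> clients I \<Longrightarrow> completion I S \<sigma> i = stop_time S \<sigma> i"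
  by (auto simp: completion_def stop_time_def intro!: proc nth_mem[THEN subsetD[rotated]])

text \<open>The end of the solution record stores the current point: \<open>move\<close> shifts the
  end, \<open>meet\<close> inserts a client just before it. The bound
  \<open>rtime S a \<le> t\<close> keeps the order sorted when a client is appended.\<close>

lemma served_schedule:
  assumes "served I V t x"
  shows "V \<subseteq> clients I \<and> 0 \<le> t \<and> (\<exists>\<sigma> S. distinct \<sigma> \<and> set \<sigma> = V \<and> sorted (map (rtime S) \<sigma>) \<and>
      (\<forall>i\<in>{1..length \<sigma> + 1}.
         stop_time S \<sigma> (i - 1) + \<bar>stop_pos S \<sigma> i - stop_pos S \<sigma> (i - 1)\<bar> \<le> stop_time S \<sigma> i) \<and>
      end_time S = t \<and> end_pos S = x \<and>
      (\<forall>a\<in>V. 0 \<le> rtime S a \<and> rtime S a \<le> t \<and> \<bar>rpos S a - start I a\<bar> \<le> speed I * rtime S a \<and>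
         ereal (rtime S a) \<le> deadline I a))"
  using assms
proof induction
  case init
  show ?case
    by (auto simp: stop_time_def stop_pos_def 
        intro!: exI[of _ "\<lparr>rtime = \<lambda>_. 0, rpos = \<lambda>_. 0, end_time = 0, end_pos = 0\<rparr>"])
next
  case (move V t x x' t')
  then obtain \<sigma> S where S: "distinct \<sigma>" "set \<sigma> = V" "sorted (map (rtime S) \<sigma>)"
     "\<And>i. i\<in>{1..length \<sigma> + 1} \<Longrightarrow>
         stop_time S \<sigma> (i - 1) + \<bar>stop_pos S \<sigma> i - stop_pos S \<sigma> (i - 1)\<bar> \<le> stop_time S \<sigma> i"
      "end_time S = t" "end_pos S = x"
      "(\<forall>a\<in>V. 0 \<le> rtime S a \<and> rtime S a \<le> t \<and> \<bar>rpos S a - start I a\<bar> \<le> speed I * rtime S a \<and>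
         ereal (rtime S a) \<le> deadline I a)"
    by blast
  define S' where "S' = S\<lparr>end_time := t', end_pos := x'\<rparr>"
  \<comment> \<open>Only the last leg changes, and there the triangle inequality absorbs the
    move.\<close>
  have "stop_time S' \<sigma> (i - 1) + \<bar>stop_pos S' \<sigma> i - stop_pos S' \<sigma> (i - 1)\<bar> \<le> stop_time S' \<sigma> i"
    if "i\<in>{1..length \<sigma> + 1}" for i
    using S(4)[OF that] S(5,6) move(2) that
    by (cases "i = length \<sigma> + 1") (auto simp: stop_time_def stop_pos_def S'_def)
  with S move show ?case
    by (intro conjI exI[of _ \<sigma>] exI[of _ S']) (force simp: S'_def)+
next
  case (meet V t x a)
  show ?case
  proof (cases "a \<in> V")
    case True then show ?thesis using meet by (simp add: insert_absorb)
  next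
    case False
    from meet obtain \<sigma> S where S: "distinct \<sigma>" "set \<sigma> = V" "sorted (map (rtime S) \<sigma>)"
     "\<And>i. i\<in>{1..length \<sigma> + 1} \<Longrightarrow>
         stop_time S \<sigma> (i - 1) + \<bar>stop_pos S \<sigma> i - stop_pos S \<sigma> (i - 1)\<bar> \<le> stop_time S \<sigma> i"
      "end_time S = t" "end_pos S = x"
      "(\<forall>a\<in>V. 0 \<le> rtime S a \<and> rtime S a \<le> t \<and> \<bar>rpos S a - start I a\<bar> \<le> speed I * rtime S a \<and>
         ereal (rtime S a) \<le> deadline I a)"
      by blast
    define S' where "S' = S\<lparr>rtime := (rtime S)(a := t), rpos := (rpos S)(a := x)\<rparr>"
    have nth: "\<sigma> ! k \<noteq> a" if "k < length \<sigma>" for k using that False S(2) by auto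
    \<comment> \<open>The new client takes index \<open>length \<sigma> + 1\<close>, where the end
      was, at the same point; the end follows by a leg of length 0.\<close>
    have st: "stop_time S' (\<sigma> @ [a]) i = stop_time S \<sigma> i" "stop_pos S' (\<sigma> @ [a]) i = stop_pos S \<sigma> i"
      if "i \<le> length \<sigma> + 1" for i
      using that S(5,6) nth[of "i - 1"]
      by (cases "i = length \<sigma> + 1"; auto simp: stop_time_def stop_pos_def S'_def nth_append)+
    have last: "stop_time S' (\<sigma> @ [a]) (length \<sigma> + 2) = t" "stop_pos S' (\<sigma> @ [a]) (length \<sigma> + 2) = x"
       "stop_time S \<sigma> (length \<sigma> + 1) = t" "stop_pos S \<sigma> (length \<sigma> + 1) = x"
      using S(5,6) by (auto simp: stop_time_def stop_pos_def S'_def)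
    have chain: "stop_time S' (\<sigma>@[a]) (i - 1) + \<bar>stop_pos S' (\<sigma>@[a]) i - stop_pos S' (\<sigma>@[a]) (i - 1)\<bar>
        \<le> stop_time S' (\<sigma>@[a]) i"
      if "i\<in>{1..length (\<sigma>@[a]) + 1}" for i
    proof (cases "i \<le> length \<sigma> + 1")
      case True then show ?thesis using S(4)[of i] that st[of i] st[of "i - 1"] by simp
    next
      case False
      then have "i = length \<sigma> + 2" using that by auto
      then show ?thesis using last st[of "length \<sigma> + 1"] by simp
    qed
    have eq: "map (rtime S') \<sigma> = map (rtime S) \<sigma>"
      using False S(2) by (auto simp: S'_def)
    have "sorted (map (rtime S') (\<sigma> @ [a]))"
      unfolding map_append eq using S(2,3,7) by (auto simp: sorted_append S'_def)
    moreover have "0 \<le> rtime S' b \<and> rtime S' b \<le> t \<and>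
        \<bar>rpos S' b - start I b\<bar> \<le> speed I * rtime S' b \<and> ereal (rtime S' b) \<le> deadline I b"
      if "b \<in> insert a V" for b
      using S(7) meet False that by (auto simp: S'_def)
    moreover have "end_time S' = t" "end_pos S' = x" using S(5,6) by (auto simp: S'_def)
    moreover have "insert a V \<subseteq> clients I" "0 \<le> t" using meet by blast+
    moreover have "distinct (\<sigma> @ [a])" "set (\<sigma> @ [a]) = insert a V" using S(1,2) False by auto
    ultimately show ?thesis
      by (intro conjI ballI exI[of _ "\<sigma> @ [a]"] exI[of _ S']) (erule chain | assumption | blast)+
  qed
qed

lemma served_feasible:
  assumes "served I (clients I) C 0"
  shows "\<exists>S. feasible I S \<and> makespan S = C"
proof -
  from served_schedule[OF assms] obtain \<sigma> S where S: "distinct \<sigma>" "set \<sigma> = clients I" "sorted (map (rtime S) \<sigma>)"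
     "\<And>i. i\<in>{1..length \<sigma> + 1} \<Longrightarrow>
         stop_time S \<sigma> (i - 1) + \<bar>stop_pos S \<sigma> i - stop_pos S \<sigma> (i - 1)\<bar> \<le> stop_time S \<sigma> i"
      "end_time S = C" "end_pos S = 0"
      "(\<forall>a\<in>clients I. 0 \<le> rtime S a \<and> \<bar>rpos S a - start I a\<bar> \<le> speed I * rtime S a \<and>
         ereal (rtime S a) \<le> deadline I a)"
    by auto
  have "length \<sigma> = card (clients I)" using S(1,2) distinct_card by metis
  then have "feasible I S"
    unfolding feasible_def using S speed_pos
    by (intro conjI exI[of _ \<sigma>]) (auto simp: completion_eq rel divide_le_eq mult.commute)
  then show ?thesis using S(5) by (auto simp: makespan_def)
qed

end

text \<open>
  The client \<open>q k\<close> is the \<open>k\<close>-th from the left. On its way from the left the server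
  enters the region of a client starting at \<open>s \<ge> 0\<close> exactly when \<open>z + v * t\<close> reaches \<open>s\<close>,
  whence the thresholds \<open>x\<close>; \<open>y\<close> collects those of the mirror image.
\<close>

locale sorted_cltsp = plain_cltsp I for I :: "'a cltsp" +
  fixes q :: "nat \<Rightarrow> 'a" and n :: nat and x y :: "nat \<Rightarrow> real" and P Q :: "nat \<Rightarrow> real \<Rightarrow> bool"
  assumes q: "bij_betw q {1..n} (clients I)"
    and q_sorted: "\<And>i j. 1 \<le> i \<Longrightarrow> i \<le> j \<Longrightarrow> j \<le> n \<Longrightarrow> start I (q i) \<le> start I (q j)"
    and x0: "x 0 = 0" and y0: "y 0 = 0"
    and x: "\<And>k. 1 \<le> k \<Longrightarrow> k \<le> n \<Longrightarrow> x k = max 0 (start I (q k))"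
    and y: "\<And>k. 1 \<le> k \<Longrightarrow> k \<le> n \<Longrightarrow> y k = max 0 (- start I (q (n + 1 - k)))"
    and P: "\<And>k t. 1 \<le> k \<Longrightarrow> k \<le> n \<Longrightarrow> P k t \<longleftrightarrow> ereal t \<le> deadline I (q k)"
    and Q: "\<And>k t. 1 \<le> k \<Longrightarrow> k \<le> n \<Longrightarrow> Q k t \<longleftrightarrow> ereal t \<le> deadline I (q (n + 1 - k))"
begin

abbreviation "v \<equiv> speed I"
abbreviation "R \<equiv> arrive v x y P Q"
abbreviation "L i j \<equiv> arrive v y x Q P j i"

section \<open>Soundness: table entries come from schedules\<close>

lemma q_client: "1 \<le> k \<Longrightarrow> k \<le> n \<Longrightarrow> q k \<in> clients I"
  using q by (auto simp: bij_betw_def)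

lemma q_ex: "a \<in> clients I \<Longrightarrow> \<exists>k\<in>{1..n}. q k = a"
  using q by (metis bij_betw_imp_surj_on image_iff)

lemma x_nonneg: "k \<le> n \<Longrightarrow> 0 \<le> x k" using x[of k] x0 by (cases k) auto
lemma y_nonneg: "k \<le> n \<Longrightarrow> 0 \<le> y k" using y[of k] y0 by (cases k) auto
lemma x_mono: "Suc i \<le> n \<Longrightarrow> x i \<le> x (Suc i)"
  using x[of i] x[of "Suc i"] q_sorted[of i "Suc i"] x0 by (cases i) auto
lemma y_mono: "Suc i \<le> n \<Longrightarrow> y i \<le> y (Suc i)"
  using y[of i] y[of "Suc i"] q_sorted[of "n - i" "n + 1 - i"] y0 by (cases i) (auto simp: max.coboundedI2)

text \<open>Each counter also passes the clients starting on the other side, at threshold 0, without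
  meeting them; hence the split by the sign of the start. A start at 0 counts as right.\<close>

definition handled :: "nat \<Rightarrow> nat \<Rightarrow> 'a set" where
  "handled i j = {q k |k. 1 \<le> k \<and> k \<le> i \<and> 0 \<le> start I (q k)} \<union>
                 {q (n + 1 - k) |k. 1 \<le> k \<and> k \<le> j \<and> start I (q (n + 1 - k)) < 0}"

lemma handled_Suc_right:
  "handled (Suc i) j = (if 0 \<le> start I (q (Suc i)) then insert (q (Suc i)) (handled i j) else handled i j)"
  unfolding handled_def collect_Suc by auto

lemma handled_Suc_left:
  "handled i (Suc j) = (if start I (q (n - j)) < 0 then insert (q (n - j)) (handled i j) else handled i j)"
  unfolding handled_def collect_Suc by auto

lemma handled_all: "handled n n = clients I"
proof -
  have "a \<in> handled n n" if "a \<in> clients I" for a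
  proof -
    from q_ex[OF that] obtain k where k: "k \<in> {1..n}" "q k = a" by blast
    then have "n + 1 - (n + 1 - k) = k" "n + 1 - k \<in> {1..n}" by auto
    with k show ?thesis unfolding handled_def
      by (cases "0 \<le> start I a") (force intro: exI[of _ "n + 1 - k"])+
  qed
  moreover have "handled n n \<subseteq> clients I" by (auto simp: handled_def intro!: q_client)
  ultimately show ?thesis by auto
qed

text \<open>
  The bound on \<open>2 * v * t\<close> says that the server, standing on one threshold, has not yet crossed
  the next one on the other side, so that the next arrival is indeed later.
\<close>

lemma arrive_sound:
  "(i \<le> n \<and> j \<le> n \<and> 0 \<le> R i j \<longrightarrow>
     served I (handled i j) (R i j) (x i - v * R i j) \<and> 2 * v * R i j \<le> x i + y j) \<and>
   (i \<le> n \<and> j \<le> n \<and> 0 \<le> L i j \<longrightarrow>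
     served I (handled i j) (L i j) (- (y j - v * L i j)) \<and> 2 * v * L i j \<le> x i + y j)"
proof (induction "i + j" arbitrary: i j rule: less_induct)
  case less
  note v = speed_pos slow
  show ?case
  proof (intro conjI impI; elim conjE)
    assume a: "i \<le> n" "j \<le> n" "0 \<le> R i j"
    have "served I (handled i j) (R i j) (x i - v * R i j) \<and> 2 * v * R i j \<le> x i + y j"
    proof (cases i)
      case 0
      then show ?thesis using a x0 y0 init by (auto simp: handled_def split: if_splits)
    next
      case (Suc k)
      define b where "b = R i j"
      have ih: "0 \<le> R k j \<Longrightarrow> served I (handled k j) (R k j) (x k - v * R k j) \<and> 2 * v * R k j \<le> x k + y j"
          "0 \<le> L k j \<Longrightarrow> served I (handled k j) (L k j) (- (y j - v * L k j)) \<and> 2 * v * L k j \<le> x k + y j"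
        using less[of k j] Suc a by auto
      have br: "b = relax v (P (Suc k)) (R k j) (L k j) (x (Suc k) - x k) (x (Suc k) + y j)"
        using Suc by (simp add: b_def)
      have b0: "0 \<le> b" using a by (simp add: b_def)
      have ok: "P (Suc k) b" and cs: "0 \<le> R k j \<and> b = R k j + (x (Suc k) - x k) / (1 + v) \<or>
          0 \<le> L k j \<and> b = (x (Suc k) + y j + (1 - v) * L k j) / (1 + v)"
        using relax_cases b0 unfolding br by blast+
      have xm: "0 \<le> x (Suc k) - x k" using x_mono[of k] Suc a by simp
      have "served I (handled k j) b (x i - v * b) \<and> 2 * v * b \<le> x i + y j"
        using cs
      proof (elim disjE conjE)
        assume c: "0 \<le> R k j" "b = R k j + (x (Suc k) - x k) / (1 + v)"
        have e: "b + v * b = R k j + v * R k j + x (Suc k) - x k"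
          using scaled_eq(2)[OF v(1) c(2)] by simp
        \<comment> \<open>Distance covered equals time elapsed: the server runs right at full
          speed.\<close>
        have "x i - v * b - (x k - v * R k j) = b - R k j"
          unfolding Suc using e by argo
        note eq = this
        have "R k j \<le> b" "2 * v * b \<le> x i + y j"
          using arrival_later[OF v, of "R k j" "x k" "y j" "x (Suc k) - x k" b] xm c(2) ih(1)[OF c(1)]
          unfolding Suc by (simp_all add: algebra_simps)
        then show ?thesis
          using served.move[OF conjunct1[OF ih(1)[OF c(1)]], of "x i - v * b" b] eq by simp
      next
        assume c: "0 \<le> L k j" "b = (x (Suc k) + y j + (1 - v) * L k j) / (1 + v)"
        have "b + v * b = x (Suc k) + y j + (1 - v) * L k j"
          using scaled_eq(1)[OF v(1) c(2)] .
        then have "x i - v * b - (- (y j - v * L k j)) = b - L k j"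
          unfolding Suc left_diff_distrib mult_1 by linarith
        note eq = this
        have "L k j \<le> b" "2 * v * b \<le> x i + y j"
          using arrival_later[OF v, of "L k j" "x k" "y j" "x (Suc k) - x k" b] xm c(2) ih(2)[OF c(1)]
          unfolding Suc by (simp_all add: algebra_simps)
        then show ?thesis
          using served.move[OF conjunct1[OF ih(2)[OF c(1)]], of "x i - v * b" b] eq by simp
      qed
      \<comment> \<open>If the start is nonnegative it equals \<open>x i\<close>, so the server
        stands exactly \<open>v * b\<close> away from it and can meet the client; otherwise
        \<open>handled\<close> does not grow.\<close>
      moreover have "served I (handled k j) b (x i - v * b) \<Longrightarrow> served I (handled i j) b (x i - v * b)"
        using ok b0 v Suc a x[of i] P[of i b] q_client[of i]
        by (auto simp: handled_Suc_right intro!: served.meet)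
      ultimately show ?thesis by (simp add: b_def)
    qed
    then show "served I (handled i j) (R i j) (x i - v * R i j)" "2 * v * R i j \<le> x i + y j" by auto
  next
    assume a: "i \<le> n" "j \<le> n" "0 \<le> L i j"
    have "served I (handled i j) (L i j) (- (y j - v * L i j)) \<and> 2 * v * L i j \<le> x i + y j"
    proof (cases j)
      case 0
      then show ?thesis using a x0 y0 init by (auto simp: handled_def split: if_splits)
    next
      case (Suc k)
      define b where "b = L i j"
      have ih: "0 \<le> R i k \<Longrightarrow> served I (handled i k) (R i k) (x i - v * R i k) \<and> 2 * v * R i k \<le> x i + y k"
          "0 \<le> L i k \<Longrightarrow> served I (handled i k) (L i k) (- (y k - v * L i k)) \<and> 2 * v * L i k \<le> x i + y k"
        using less[of i k] Suc a by auto
      have br: "b = relax v (Q (Suc k)) (L i k) (R i k) (y (Suc k) - y k) (y (Suc k) + x i)"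
        using Suc by (simp add: b_def)
      have b0: "0 \<le> b" using a by (simp add: b_def)
      have ok: "Q (Suc k) b" and cs: "0 \<le> L i k \<and> b = L i k + (y (Suc k) - y k) / (1 + v) \<or>
          0 \<le> R i k \<and> b = (y (Suc k) + x i + (1 - v) * R i k) / (1 + v)"
        using relax_cases b0 unfolding br by blast+
      have xm: "0 \<le> y (Suc k) - y k" using y_mono[of k] Suc a by simp
      have "served I (handled i k) b (- (y j - v * b)) \<and> 2 * v * b \<le> x i + y j"
        using cs
      proof (elim disjE conjE)
        assume c: "0 \<le> L i k" "b = L i k + (y (Suc k) - y k) / (1 + v)"
        have e: "b + v * b = L i k + v * L i k + y (Suc k) - y k"
          using scaled_eq(2)[OF v(1) c(2)] by simp
        have "- (y j - v * b) - (- (y k - v * L i k)) = - (b - L i k)"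
          unfolding Suc using e by argo
        note eq = this
        have "L i k \<le> b" "2 * v * b \<le> x i + y j"
          using arrival_later[OF v, of "L i k" "x i" "y k" "y (Suc k) - y k" b] xm c(2) ih(2)[OF c(1)]
          unfolding Suc by (simp_all add: algebra_simps)
        then show ?thesis
          using served.move[OF conjunct1[OF ih(2)[OF c(1)]], of "- (y j - v * b)" b] eq by simp
      next
        assume c: "0 \<le> R i k" "b = (y (Suc k) + x i + (1 - v) * R i k) / (1 + v)"
        have "b + v * b = y (Suc k) + x i + (1 - v) * R i k"
          using scaled_eq(1)[OF v(1) c(2)] .
        then have "- (y j - v * b) - (x i - v * R i k) = - (b - R i k)"
          unfolding Suc left_diff_distrib mult_1 by linarith
        note eq = this
        have "R i k \<le> b" "2 * v * b \<le> x i + y j"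
          using arrival_later[OF v, of "R i k" "x i" "y k" "y (Suc k) - y k" b] xm c(2) ih(1)[OF c(1)]
          unfolding Suc by (simp_all add: algebra_simps)
        then show ?thesis
          using served.move[OF conjunct1[OF ih(1)[OF c(1)]], of "- (y j - v * b)" b] eq by simp
      qed
      moreover have "served I (handled i k) b (- (y j - v * b)) \<Longrightarrow> served I (handled i j) b (- (y j - v * b))"
        using ok b0 v Suc a y[of j] Q[of j b] q_client[of "n - k"]
        by (auto simp: handled_Suc_left intro!: served.meet)
      ultimately show ?thesis by (simp add: b_def)
    qed
    then show "served I (handled i j) (L i j) (- (y j - v * L i j))" "2 * v * L i j \<le> x i + y j" by auto
  qed
qed

lemma returns:
  "0 \<le> R n n \<Longrightarrow> served I (clients I) (R n n + \<bar>x n - v * R n n\<bar>) 0"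
  "0 \<le> L n n \<Longrightarrow> served I (clients I) (L n n + \<bar>y n - v * L n n\<bar>) 0"
proof -
  assume "0 \<le> R n n"
  then have "served I (clients I) (R n n) (x n - v * R n n)"
    using arrive_sound[of n n] by (simp add: handled_all)
  then show "served I (clients I) (R n n + \<bar>x n - v * R n n\<bar>) 0"
    by (rule served.move) simp
next
  assume "0 \<le> L n n"
  then have "served I (clients I) (L n n) (- (y n - v * L n n))"
    using arrive_sound[of n n] by (simp add: handled_all)
  then show "served I (clients I) (L n n + \<bar>y n - v * L n n\<bar>) 0"
    by (rule served.move) simp
qed

text \<open>
  Being able to reach \<open>z\<close> by time \<open>t\<close> from the state \<open>(i, j)\<close> is the invariant
  along an arbitrary feasible solution.
\<close>

definition avail :: "nat \<Rightarrow> nat \<Rightarrow> real \<Rightarrow> real \<Rightarrow> bool" where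
  "avail i j t z \<longleftrightarrow> 0 \<le> R i j \<and> R i j + \<bar>z - (x i - v * R i j)\<bar> \<le> t \<or>
                   0 \<le> L i j \<and> L i j + \<bar>- z - (y j - v * L i j)\<bar> \<le> t"

section \<open>Completeness: table entries dominate every feasible solution\<close>

lemma avail_move: "avail i j t z \<Longrightarrow> \<bar>z' - z\<bar> \<le> t' - t \<Longrightarrow> avail i j t' z'"
  unfolding avail_def by (elim disjE) auto

text \<open>\<open>b\<close> is the candidate of \<open>relax\<close> belonging to the state that
  witnesses \<open>av\<close>. Its cone contains the point by \<open>cone_meets_line\<close>; the
  table entry is at most \<open>b\<close> by \<open>relax_le\<close>, and its cone is larger by
  \<open>cone_mono\<close>.\<close>

lemma avail_right_step:
  assumes av: "avail i j t z" and le: "Suc i \<le> n" "j \<le> n" and X: "x (Suc i) \<le> z + v * t"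
    and d: "ereal t \<le> deadline I (q (Suc i))"
  shows "avail (Suc i) j t z"
proof -
  note v = speed_pos slow
  obtain b where b: "0 \<le> R i j \<and> b = R i j + (x (Suc i) - x i) / (1 + v) \<or>
      0 \<le> L i j \<and> b = (x (Suc i) + y j + (1 - v) * L i j) / (1 + v)"
    and bz: "b + \<bar>z - (x (Suc i) - v * b)\<bar> \<le> t"
  proof -
    from av[unfolded avail_def] show ?thesis
    proof (elim disjE conjE)
      assume c: "0 \<le> R i j" "R i j + \<bar>z - (x i - v * R i j)\<bar> \<le> t"
      show ?thesis
        using v c(1) by (intro that[OF _ cone_meets_line[OF v c(2) X refl]]) (auto simp: field_simps)
    next
      assume c: "0 \<le> L i j" "L i j + \<bar>- z - (y j - v * L i j)\<bar> \<le> t"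
      then have c': "L i j + \<bar>z - (v * L i j - y j)\<bar> \<le> t" by auto
      show ?thesis
        using v c(1) by (intro that[OF _ cone_meets_line[OF v c' X refl]]) (auto simp: field_simps)
    qed
  qed
  have b0: "0 \<le> b" using b x_mono[of i] x_nonneg[of "Suc i"] y_nonneg[of j] le v by auto
  \<comment> \<open>The deadline is assumed at the observed time \<open>t\<close> only; the
    backdated crossing and anything earlier come before it.\<close>
  have okm: "P (Suc i) c" if "c \<le> b" for c
  proof -
    have "c \<le> t" using that bz by linarith
    then show ?thesis using P[of "Suc i" c] le d by (simp add: order_trans[of "ereal c" "ereal t"])
  qed
  have "0 \<le> R (Suc i) j" "R (Suc i) j \<le> b"
    unfolding arrive.simps using x_mono[of i] x_nonneg[of "Suc i"] y_nonneg[of j] le v b b0 okm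
    by (intro relax_le; simp)+
  then show ?thesis unfolding avail_def using cone_mono[OF v bz] by blast
qed

lemma avail_left_step:
  assumes av: "avail i j t z" and le: "i \<le> n" "Suc j \<le> n" and X: "y (Suc j) \<le> - z + v * t"
    and d: "ereal t \<le> deadline I (q (n - j))"
  shows "avail i (Suc j) t z"
proof -
  note v = speed_pos slow
  obtain b where b: "0 \<le> L i j \<and> b = L i j + (y (Suc j) - y j) / (1 + v) \<or>
      0 \<le> R i j \<and> b = (y (Suc j) + x i + (1 - v) * R i j) / (1 + v)"
    and bz: "b + \<bar>- z - (y (Suc j) - v * b)\<bar> \<le> t"
  proof -
    from av[unfolded avail_def] show ?thesis
    proof (elim disjE conjE)
      assume c: "0 \<le> L i j" "L i j + \<bar>- z - (y j - v * L i j)\<bar> \<le> t"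
      show ?thesis
        using v c(1) by (intro that[OF _ cone_meets_line[OF v c(2) X refl]]) (auto simp: field_simps)
    next
      assume c: "0 \<le> R i j" "R i j + \<bar>z - (x i - v * R i j)\<bar> \<le> t"
      then have c': "R i j + \<bar>- z - (v * R i j - x i)\<bar> \<le> t" by auto
      show ?thesis
        using v c(1) by (intro that[OF _ cone_meets_line[OF v c' X refl]]) (auto simp: field_simps)
    qed
  qed
  have b0: "0 \<le> b" using b y_mono[of j] y_nonneg[of "Suc j"] x_nonneg[of i] le v by auto
  have okm: "Q (Suc j) c" if "c \<le> b" for c
  proof -
    have "c \<le> t" using that bz by linarith
    then show ?thesis using Q[of "Suc j" c] le d by (simp add: order_trans[of "ereal c" "ereal t"])
  qed
  have "0 \<le> L i (Suc j)" "L i (Suc j) \<le> b"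
    unfolding arrive.simps using y_mono[of j] y_nonneg[of "Suc j"] x_nonneg[of i] le v b b0 okm
    by (intro relax_le; simp)+
  then show ?thesis unfolding avail_def using cone_mono[OF v bz] by blast
qed

lemma avail_right:
  assumes "avail i j t z" "i \<le> i'" "i' \<le> n" "j \<le> n"
    and "\<And>k. i < k \<Longrightarrow> k \<le> i' \<Longrightarrow> x k \<le> z + v * t \<and> ereal t \<le> deadline I (q k)"
  shows "avail i' j t z"
  using assms(2,1,3-)
proof (induction i' rule: dec_induct)
  case (step m)
  then show ?case using step.prems(4)[of "Suc m"] by (auto intro!: avail_right_step)
qed auto

lemma avail_left:
  assumes "avail i j t z" "j \<le> j'" "j' \<le> n" "i \<le> n"
    and "\<And>k. j < k \<Longrightarrow> k \<le> j' \<Longrightarrow> y k \<le> - z + v * t \<and> ereal t \<le> deadline I (q (n + 1 - k))"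
  shows "avail i j' t z"
  using assms(2,1,3-)
proof (induction j' rule: dec_induct)
  case (step m)
  then show ?case using step.prems(4)[of "Suc m"] by (auto intro!: avail_left_step)
qed auto

text \<open>Meeting client \<open>k\<close> gives \<open>start I (q k) \<le> z + v * t\<close> and
  \<open>- start I (q k) \<le> - z + v * t\<close>. As the starts are sorted, all right thresholds
  up to \<open>k\<close> and all left ones up to \<open>n + 1 - k\<close> are crossed;
  \<open>right\<close> and \<open>left\<close> ensure that those not passed before are genuine
  starts rather than the default 0.\<close>

lemma avail_serve:
  assumes av: "avail i j t z" and le: "i \<le> n" "j \<le> n" and k: "1 \<le> k" "k \<le> n"
    and near: "\<bar>z - start I (q k)\<bar> \<le> v * t"
    and right: "\<And>l. 1 \<le> l \<Longrightarrow> l \<le> n \<Longrightarrow> i < l \<Longrightarrow> 0 < start I (q l) \<and> ereal t \<le> deadline I (q l)"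
    and left: "\<And>l. 1 \<le> l \<Longrightarrow> l \<le> n \<Longrightarrow> j < n + 1 - l \<Longrightarrow> start I (q l) < 0 \<and> ereal t \<le> deadline I (q l)"
  shows "avail (max i k) (max j (n + 1 - k)) t z"
proof -
  have "avail (max i k) j t z"
  proof (rule avail_right[OF av])
    fix l assume l: "i < l" "l \<le> max i k"
    then have "l \<le> k" by auto
    with l k show "x l \<le> z + v * t \<and> ereal t \<le> deadline I (q l)"
      using right[of l] x[of l] q_sorted[of l k] near by (auto simp: abs_le_iff)
  qed (use le k in auto)
  then show ?thesis
  proof (rule avail_left)
    fix l assume l: "j < l" "l \<le> max j (n + 1 - k)"
    then have "l \<le> n + 1 - k" by auto
    then have "k \<le> n + 1 - l" "1 \<le> n + 1 - l" "n + 1 - l \<le> n" using k l by auto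
    with l k show "y l \<le> - z + v * t \<and> ereal t \<le> deadline I (q (n + 1 - l))"
      using left[of "n + 1 - l"] y[of l] q_sorted[of k "n + 1 - l"] near
      by (auto simp: abs_le_iff)
  qed (use le k in auto)
qed

text \<open>
  The stop at the origin at time \<open>0\<close> passes all thresholds that vanish.
\<close>

lemma avail_start:
  "\<exists>i\<le>n. \<exists>j\<le>n. avail i j 0 0 \<and>
     (\<forall>k. 1 \<le> k \<and> k \<le> n \<longrightarrow> (start I (q k) \<le> 0 \<longrightarrow> k \<le> i) \<and> (0 \<le> start I (q k) \<longrightarrow> n + 1 - k \<le> j))"
proof -
  define A where "A = {k. 1 \<le> k \<and> k \<le> n \<and> start I (q k) \<le> 0}"
  define B where "B = {k. 1 \<le> k \<and> k \<le> n \<and> 0 \<le> start I (q (n + 1 - k))}"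
  have fin: "finite A" "finite B" by (auto simp: A_def B_def)
  \<comment> \<open>The inserted 0 covers the case of no client at or left of the origin; by
    sortedness all indices up to \<open>i\<close> have threshold 0.\<close>
  define i where "i = Max (insert 0 A)"
  define j where "j = Max (insert 0 B)"
  have iA: "i \<in> insert 0 A" and jB: "j \<in> insert 0 B" unfolding i_def j_def using fin by (intro Max_in; simp)+
  then have le: "i \<le> n" "j \<le> n" by (auto simp: A_def B_def)
  have iu: "k \<le> i" if "k \<in> A" for k using that fin unfolding i_def by simp
  have ju: "k \<le> j" if "k \<in> B" for k using that fin unfolding j_def by simp
  have "avail 0 0 0 0" by (auto simp: avail_def x0)
  then have "avail i 0 0 0"
  proof (rule avail_right)
    fix k assume k: "0 < k" "k \<le> i"
    then have "i \<in> A" using iA by auto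
    \<comment> \<open>Deadlines are nonnegative, so none is violated at time 0.\<close>
    then show "x k \<le> 0 + v * 0 \<and> ereal 0 \<le> deadline I (q k)"
      using k q_sorted[of k i] x[of k] deadline_nonneg[OF q_client[of k]]
      by (auto simp: A_def zero_ereal_def[symmetric])
  qed (use le in auto)
  then have "avail i j 0 0"
  proof (rule avail_left)
    fix k assume k: "0 < k" "k \<le> j"
    then have "j \<in> B" using jB by auto
    moreover have "n + 1 - j \<le> n + 1 - k" "1 \<le> n + 1 - j" "n + 1 - k \<le> n" "1 \<le> n + 1 - k"
      using k le by auto
    ultimately show "y k \<le> - 0 + v * 0 \<and> ereal 0 \<le> deadline I (q (n + 1 - k))"
      using k q_sorted[of "n + 1 - j" "n + 1 - k"] y[of k] deadline_nonneg[OF q_client[of "n + 1 - k"]] le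
      by (auto simp: B_def zero_ereal_def[symmetric] max_def)
  qed (use le in auto)
  moreover have "n + 1 - k \<le> j" if "1 \<le> k" "k \<le> n" "0 \<le> start I (q k)" for k
    using that by (intro ju) (auto simp: B_def)
  moreover have "k \<le> i" if "1 \<le> k" "k \<le> n" "start I (q k) \<le> 0" for k
    using that by (intro iu) (auto simp: A_def)
  ultimately show ?thesis using le by blast
qed

text \<open>Induction along the stops. A met client is required to lie behind both counters,
  whichever side it starts on, so the clients beyond a counter are unmet and start strictly on its
  side, as \<open>avail_serve\<close> demands.\<close>

lemma feasible_avail:
  assumes "feasible I S"
  shows "avail n n (makespan S) 0"
proof -
  from assms obtain \<sigma> where \<sigma>: "distinct \<sigma>" "set \<sigma> = clients I" "sorted (map (rtime S) \<sigma>)"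
    and st: "\<And>i. i\<in>{1..card (clients I) + 1} \<Longrightarrow>
             completion I S \<sigma> (i - 1) + \<bar>stop_pos S \<sigma> i - stop_pos S \<sigma> (i - 1)\<bar> \<le> stop_time S \<sigma> i"
    and e0: "end_pos S = 0"
    and cl: "\<And>a. a\<in>clients I \<Longrightarrow>
        release I a + \<bar>rpos S a - start I a\<bar> / speed I \<le> rtime S a \<and>
        ereal (rtime S a) \<le> deadline I a"
    unfolding feasible_def by auto
  have len: "length \<sigma> = card (clients I)" using \<sigma>(1,2) distinct_card by metis
  have mv: "\<bar>stop_pos S \<sigma> (Suc m) - stop_pos S \<sigma> m\<bar> \<le> stop_time S \<sigma> (Suc m) - stop_time S \<sigma> m"
    if "m \<le> length \<sigma>" for m
    using st[of "Suc m"] that len by (simp add: completion_eq \<sigma>(2))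
  have near: "\<bar>rpos S a - start I a\<bar> \<le> v * rtime S a" if "a \<in> clients I" for a
    using cl[OF that] rel[OF that] speed_pos by (simp add: divide_le_eq mult.commute)
  define inv where "inv m i j \<longleftrightarrow> avail i j (stop_time S \<sigma> m) (stop_pos S \<sigma> m) \<and>
     (\<forall>k. 1 \<le> k \<and> k \<le> n \<longrightarrow> (q k \<in> set (take m \<sigma>) \<or> start I (q k) \<le> 0 \<longrightarrow> k \<le> i) \<and>
          (q k \<in> set (take m \<sigma>) \<or> 0 \<le> start I (q k) \<longrightarrow> n + 1 - k \<le> j))" for m i j
  have "\<exists>i\<le>n. \<exists>j\<le>n. inv m i j" if "m \<le> length \<sigma>" for m
    using that
  proof (induction m)
    case 0
    then show ?case using avail_start by (simp add: inv_def stop_time_def stop_pos_def)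
  next
    case (Suc m)
    then obtain i j where ij: "i \<le> n" "j \<le> n" "inv m i j" by auto
    define a where "a = \<sigma> ! m"
    have a: "a \<in> clients I" unfolding a_def \<sigma>(2)[symmetric] using Suc.prems by simp
    from q_ex[OF a] obtain k where "k \<in> {1..n}" "q k = a" by blast
    then have k: "1 \<le> k" "k \<le> n" "q k = a" by auto
    have at: "stop_time S \<sigma> (Suc m) = rtime S a" "stop_pos S \<sigma> (Suc m) = rpos S a"
      using Suc.prems by (auto simp: stop_time_def stop_pos_def a_def)
    \<comment> \<open>An unmet client has its own rendezvous no earlier than the current stop, and
      its deadline allows that rendezvous.\<close>
    have later: "ereal (rtime S a) \<le> deadline I (q l)" if "1 \<le> l" "l \<le> n" "q l \<notin> set (take m \<sigma>)" for l
    proof -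
      have "q l \<in> set \<sigma>" using that q_client \<sigma>(2) by auto
      then obtain p where p: "p < length \<sigma>" "\<sigma> ! p = q l" by (auto simp: in_set_conv_nth)
      then have "m \<le> p" using that(3) by (metis in_set_conv_nth length_take min_less_iff_conj not_le nth_take)
      then have "rtime S a \<le> rtime S (q l)"
        using sorted_nth_mono[OF \<sigma>(3), of m p] p by (simp add: a_def)
      also have "ereal \<dots> \<le> deadline I (q l)" using cl q_client that by blast
      finally show ?thesis by simp
    qed
    have "avail i j (rtime S a) (rpos S a)"
      using ij(3) avail_move mv[of m] Suc.prems at unfolding inv_def by auto
    then have "avail (max i k) (max j (n + 1 - k)) (rtime S a) (rpos S a)"
    proof (rule avail_serve[OF _ ij(1,2) k(1,2)])
      show "\<bar>rpos S a - start I (q k)\<bar> \<le> v * rtime S a" using near a k by simp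
      show "0 < start I (q l) \<and> ereal (rtime S a) \<le> deadline I (q l)" if "1 \<le> l" "l \<le> n" "i < l" for l
        using that later[of l] ij(3) unfolding inv_def by (meson not_le)
      show "start I (q l) < 0 \<and> ereal (rtime S a) \<le> deadline I (q l)"
        if "1 \<le> l" "l \<le> n" "j < n + 1 - l" for l
        using that later[of l] ij(3) unfolding inv_def by (meson not_le)
    qed
    moreover have "set (take (Suc m) \<sigma>) = insert a (set (take m \<sigma>))"
      using Suc.prems by (simp add: take_Suc_conv_app_nth a_def)
    moreover have "l = k" if "1 \<le> l" "l \<le> n" "q l = a" for l
      using inj_onD[OF bij_betw_imp_inj_on[OF q], of l k] that k by simp
    ultimately have "inv (Suc m) (max i k) (max j (n + 1 - k))"
      using ij(3) at unfolding inv_def by (auto simp: le_max_iff_disj)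
    then show ?case using ij k by (intro exI[of _ "max i k"] exI[of _ "max j (n + 1 - k)"] conjI) auto
  qed
  from this[of "length \<sigma>"] obtain i j where ij: "i \<le> n" "j \<le> n" "inv (length \<sigma>) i j" by auto
  have "i = n" "j = n"
  proof -
    \<comment> \<open>At the end every client is met: client \<open>n\<close> forces the right
      counter to \<open>n\<close>, client \<open>1\<close>, with mirrored index \<open>n\<close>,
      the left one.\<close>
    have "n \<le> i \<and> n \<le> j" if "n \<noteq> 0"
      using ij(3) q_client[of n] q_client[of 1] \<sigma>(2) that unfolding inv_def
      by simp (metis One_nat_def Suc_leI diff_Suc_1 le_refl not_gr_zero)
    then show "i = n" "j = n" using ij by auto
  qed
  then have "avail n n (stop_time S \<sigma> (length \<sigma>)) (stop_pos S \<sigma> (length \<sigma>))"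
    using ij(3) by (simp add: inv_def)
  from avail_move[OF this mv] e0 show ?thesis
    by (simp add: stop_time_def stop_pos_def makespan_def)
qed

lemma feasible_bound:
  assumes "feasible I S"
  shows "0 \<le> R n n \<and> R n n + \<bar>x n - v * R n n\<bar> \<le> makespan S \<or>
         0 \<le> L n n \<and> L n n + \<bar>y n - v * L n n\<bar> \<le> makespan S"
  using feasible_avail[OF assms] by (auto simp: avail_def abs_minus_commute)

lemma best_return_correct: "correct_answer I (best_return v (R n n) (x n) (L n n) (y n))"
proof (cases "R n n < 0 \<and> L n n < 0")
  case True
  then show ?thesis using feasible_bound by (auto simp: best_return_def correct_answer_def)
next
  case False
  define a where "a = R n n + \<bar>x n - v * R n n\<bar>"
  define b where "b = L n n + \<bar>y n - v * L n n\<bar>"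
  have ret: "0 \<le> R n n \<Longrightarrow> \<exists>S. feasible I S \<and> makespan S = a"
      "0 \<le> L n n \<Longrightarrow> \<exists>S. feasible I S \<and> makespan S = b"
    unfolding a_def b_def by (intro served_feasible returns; assumption)+
  have bnd: "0 \<le> R n n \<and> a \<le> makespan S \<or> 0 \<le> L n n \<and> b \<le> makespan S" if "feasible I S" for S
    using feasible_bound[OF that] by (simp add: a_def b_def)
  have "best_return v (R n n) (x n) (L n n) (y n) =
      Some (if R n n < 0 then b else if L n n < 0 then a else min a b)"
    using False by (simp add: best_return_def a_def b_def)
  moreover have "min_makespan I (if R n n < 0 then b else if L n n < 0 then a else min a b)"
    unfolding min_makespan_def using False ret bnd by (auto simp: min_def not_less) force+
  ultimately show ?thesis by (simp add: correct_answer_def)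
qed

end

section \<open>Weakest preconditions with running time\<close>

text \<open>The exact running time is an argument of the postcondition, and the existential
  expresses termination.\<close>

definition wp :: "com \<Rightarrow> (nat \<Rightarrow> mem \<Rightarrow> bool) \<Rightarrow> mem \<Rightarrow> bool" where
  "wp c Q m \<longleftrightarrow> (\<exists>k m'. exec c m k m' \<and> Q k m')"

lemma wp_mono: "wp c Q m \<Longrightarrow> (\<And>k m'. Q k m' \<Longrightarrow> Q' k m') \<Longrightarrow> wp c Q' m"
  unfolding wp_def by blast

lemma wp_simps [simp]:
  "wp Skip Q m \<longleftrightarrow> Q 1 m"
  "wp (NAssign x i e) Q m \<longleftrightarrow> Q (ncost i + ncost e + 1)
     (m\<lparr>nmem := (nmem m)(x := (nmem m x)(nval i m := nval e m))\<rparr>)"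
  "wp (RAssign x i r) Q m \<longleftrightarrow> Q (ncost i + rcost r + 1)
     (m\<lparr>rmem := (rmem m)(x := (rmem m x)(nval i m := rval r m))\<rparr>)"
  "wp (Seq c1 c2) Q m \<longleftrightarrow> wp c1 (\<lambda>k1. wp c2 (\<lambda>k2. Q (k1 + k2))) m"
  "wp (Cond b c1 c2) Q m \<longleftrightarrow>
     (if bval b m then wp c1 (\<lambda>k. Q (bcost b + k + 1)) m else wp c2 (\<lambda>k. Q (bcost b + k + 1)) m)"
proof -
  show "wp Skip Q m \<longleftrightarrow> Q 1 m"
    unfolding wp_def by (metis exec.Skip exec_SkipE)
  show "wp (NAssign x i e) Q m \<longleftrightarrow> Q (ncost i + ncost e + 1)
     (m\<lparr>nmem := (nmem m)(x := (nmem m x)(nval i m := nval e m))\<rparr>)"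
    unfolding wp_def by (metis exec.NAssign exec_NAssignE)
  show "wp (RAssign x i r) Q m \<longleftrightarrow> Q (ncost i + rcost r + 1)
     (m\<lparr>rmem := (rmem m)(x := (rmem m x)(nval i m := rval r m))\<rparr>)"
    unfolding wp_def by (metis exec.RAssign exec_RAssignE)
  show "wp (Seq c1 c2) Q m \<longleftrightarrow> wp c1 (\<lambda>k1. wp c2 (\<lambda>k2. Q (k1 + k2))) m"
    unfolding wp_def by (metis exec.Seq exec_SeqE)
  show "wp (Cond b c1 c2) Q m \<longleftrightarrow>
     (if bval b m then wp c1 (\<lambda>k. Q (bcost b + k + 1)) m else wp c2 (\<lambda>k. Q (bcost b + k + 1)) m)"
  proof (cases "bval b m")
    case True
    then have "exec (Cond b c1 c2) m k m' \<longleftrightarrow> (\<exists>l. exec c1 m l m' \<and> k = bcost b + l + 1)" for k m'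
      by (auto elim: exec_CondE intro: exec.CondTrue[simplified])
    with True show ?thesis unfolding wp_def by auto
  next
    case False
    then have "exec (Cond b c1 c2) m k m' \<longleftrightarrow> (\<exists>l. exec c2 m l m' \<and> k = bcost b + l + 1)" for k m'
      by (auto elim: exec_CondE intro: exec.CondFalse[simplified])
    with False show ?thesis unfolding wp_def by auto
  qed
qed

text \<open>The number \<open>N\<close> of rounds is known beforehand, so the index of the invariant
  also proves termination. A round costs at most \<open>K\<close>, the guard and one unit; the
  failing guard is paid once more.\<close>

lemma wp_Loop:
  assumes step: "\<And>k m. k < N \<Longrightarrow> Inv k m \<Longrightarrow> bval b m \<and> wp c (\<lambda>t m'. t \<le> K \<and> Inv (Suc k) m') m"
    and stop: "\<And>m. Inv N m \<Longrightarrow> \<not> bval b m"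
    and init: "Inv 0 m"
  shows "wp (Loop b c) (\<lambda>t m'. t \<le> N * (K + bcost b + 1) + bcost b + 1 \<and> Inv N m') m"
proof -
  \<comment> \<open>Induction on the number \<open>j\<close> of rounds still to come.\<close>
  have "wp (Loop b c) (\<lambda>t m'. t \<le> j * (K + bcost b + 1) + bcost b + 1 \<and> Inv N m') m"
    if "Inv (N - j) m" "j \<le> N" for j m
    using that
  proof (induction j arbitrary: m)
    case 0
    then show ?case using stop by (auto simp: wp_def intro!: exec.LoopFalse exI)
  next
    case (Suc j)
    then have "bval b m" "wp c (\<lambda>t m'. t \<le> K \<and> Inv (Suc (N - Suc j)) m') m"
      using step[of "N - Suc j" m] by auto
    then obtain t1 m1 where 1: "exec c m t1 m1" "t1 \<le> K" "Inv (N - j) m1"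
      using Suc.prems by (auto simp: wp_def Suc_diff_Suc)
    then obtain t2 m2 where 2: "exec (Loop b c) m1 t2 m2" "t2 \<le> j * (K + bcost b + 1) + bcost b + 1" "Inv N m2"
      using Suc.IH[of m1] Suc.prems by (auto simp: wp_def)
    show ?case unfolding wp_def
      using exec.LoopTrue[OF \<open>bval b m\<close> 1(1) 2(1)] 1(2) 2(2,3)
      by (intro exI conjI) (assumption | simp)+
  qed
  from this[of N m] init show ?thesis by simp
qed

abbreviation nvar :: "string \<Rightarrow> nexp" where "nvar z \<equiv> NCell z (NConst 0)"
abbreviation rvar :: "string \<Rightarrow> rexp" where "rvar z \<equiv> RCell z (NConst 0)"
abbreviation nset :: "string \<Rightarrow> nexp \<Rightarrow> com" (infix "::=" 60) where "z ::= e \<equiv> NAssign z (NConst 0) e"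
abbreviation rset :: "string \<Rightarrow> rexp \<Rightarrow> com" (infix ":::=" 60) where "z :::= e \<equiv> RAssign z (NConst 0) e"
abbreviation seq_infix :: "com \<Rightarrow> com \<Rightarrow> com" (infixr ";;" 55) where "c ;; d \<equiv> Seq c d"

section \<open>Sorting\<close>

text \<open>Breaking ties by the index gives a strict total order, so equal starts receive different
  ranks.\<close>

definition precedes :: "(nat \<Rightarrow> real) \<Rightarrow> nat \<Rightarrow> nat \<Rightarrow> bool" where
  "precedes s j i \<longleftrightarrow> s j < s i \<or> s j = s i \<and> j < i"

text \<open>Sorting by counting predecessors is quadratic, which the time bound permits, and writes
  every client directly to its final cell.\<close>

definition rank :: "(nat \<Rightarrow> real) \<Rightarrow> nat \<Rightarrow> nat \<Rightarrow> nat" where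
  "rank s n i = card {j. j < n \<and> precedes s j i}"

lemma rank_Suc: "rank s (Suc n) i = (if precedes s n i then Suc (rank s n i) else rank s n i)"
proof -
  have "{j. j < Suc n \<and> precedes s j i} =
      (if precedes s n i then insert n {j. j < n \<and> precedes s j i} else {j. j < n \<and> precedes s j i})"
    by (auto simp: less_Suc_eq)
  then show ?thesis by (simp add: rank_def)
qed

text \<open>Every predecessor of \<open>i\<close> precedes \<open>j\<close> by transitivity, and
  \<open>i\<close> itself is one more.\<close>

lemma rank_strict_mono:
  assumes "precedes s i j" "i < n"
  shows "rank s n i < rank s n j"
  unfolding rank_def using assms
  by (intro psubset_card_mono) (auto simp: precedes_def)

lemma rank_less: "i < n \<Longrightarrow> rank s n i < n"
proof -
  assume "i < n"
  then have "{j. j < n \<and> precedes s j i} \<subset> {..<n}" by (auto simp: precedes_def)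
  from psubset_card_mono[OF _ this] show ?thesis by (simp add: rank_def)
qed

lemma rank_inj: "inj_on (rank s n) {..<n}"
proof (rule inj_onI)
  fix i j assume "i \<in> {..<n}" "j \<in> {..<n}" "rank s n i = rank s n j"
  then show "i = j"
    using rank_strict_mono[of s i j n] rank_strict_mono[of s j i n]
    by (auto simp: precedes_def) (metis linorder_neqE_linordered_idom linorder_neqE_nat)
qed

lemma rank_bij: "bij_betw (rank s n) {..<n} {..<n}"
  using rank_inj[of s n] rank_less[of _ n s] unfolding bij_betw_def
  by (intro conjI endo_inj_surj) auto

text \<open>The language has no disjunction, so \<open>precedes\<close> is written with
  \<open>BNot\<close> and \<open>BAnd\<close>.\<close>

definition rank_loop :: com where
  "rank_loop =
     Loop (NLess (nvar ''j'') (nvar ''n''))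
      (Cond (BNot (BAnd
          (BNot (RLess (RCell ''s'' (nvar ''j'')) (RCell ''s'' (nvar ''i''))))
          (BNot (BAnd (BNot (RLess (RCell ''s'' (nvar ''i'')) (RCell ''s'' (nvar ''j''))))
                      (NLess (nvar ''j'') (nvar ''i''))))))
         (''k'' ::= NAdd (nvar ''k'') (NConst 1)) Skip ;;
       ''j'' ::= NAdd (nvar ''j'') (NConst 1))"

lemma wp_rank_loop:
  assumes "nmem m ''j'' 0 = 0" "nmem m ''k'' 0 = 0"
  shows "wp rank_loop (\<lambda>t m'. t \<le> nmem m ''n'' 0 * 60 + 10 \<and> rmem m' = rmem m \<and>
      (\<forall>z. z \<notin> {''j'', ''k''} \<longrightarrow> nmem m' z = nmem m z) \<and>
      nmem m' ''k'' 0 = rank (rmem m ''s'') (nmem m ''n'' 0) (nmem m ''i'' 0)) m"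
proof -
  let ?Inv = "\<lambda>l m'. rmem m' = rmem m \<and> (\<forall>z. z \<notin> {''j'', ''k''} \<longrightarrow> nmem m' z = nmem m z) \<and>
      nmem m' ''j'' 0 = l \<and> nmem m' ''k'' 0 = rank (rmem m ''s'') l (nmem m ''i'' 0)"
  show ?thesis unfolding rank_loop_def
    \<comment> \<open>With guard cost 5 a round takes at most 56 units, rounded up to 60; later time
      bounds are generous in the same way.\<close>
    by (rule wp_mono[OF wp_Loop[where N = "nmem m ''n'' 0" and K = 50 and Inv = ?Inv]])
      (use assms in \<open>auto simp: rank_Suc precedes_def rank_def[of _ 0]\<close>)
qed

text \<open>Thresholds are numbered from 1, hence rank plus one; \<open>n + 1 - k\<close> is the
  same client counted from the right. Cells 0 of \<open>''x''\<close> and \<open>''y''\<close> are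
  left alone and keep the threshold 0.\<close>

definition sort_loop :: com where
  "sort_loop =
     Loop (NLess (nvar ''i'') (nvar ''n''))
      (''k'' ::= NConst 0 ;; ''j'' ::= NConst 0 ;; rank_loop ;;
       ''k'' ::= NAdd (nvar ''k'') (NConst 1) ;;
       Cond (RLess (RConst 0) (RCell ''s'' (nvar ''i'')))
         (RAssign ''x'' (nvar ''k'') (RCell ''s'' (nvar ''i'')))
         (RAssign ''x'' (nvar ''k'') (RConst 0)) ;;
       Cond (RLess (RCell ''s'' (nvar ''i'')) (RConst 0))
         (RAssign ''y'' (NSub (NAdd (nvar ''n'') (NConst 1)) (nvar ''k''))
           (RSub (RConst 0) (RCell ''s'' (nvar ''i''))))
         (RAssign ''y'' (NSub (NAdd (nvar ''n'') (NConst 1)) (nvar ''k'')) (RConst 0)) ;;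
       RAssign ''e'' (nvar ''k'') (RCell ''d'' (nvar ''i'')) ;;
       NAssign ''f'' (nvar ''k'') (NCell ''inf'' (nvar ''i'')) ;;
       ''i'' ::= NAdd (nvar ''i'') (NConst 1))"

definition sorted_data :: "mem \<Rightarrow> nat \<Rightarrow> mem \<Rightarrow> bool" where
  "sorted_data m l m' \<longleftrightarrow> rmem m' ''x'' 0 = 0 \<and> rmem m' ''y'' 0 = 0 \<and>
     (\<forall>i<l. let k = Suc (rank (rmem m ''s'') (nmem m ''n'' 0) i) in
        rmem m' ''x'' k = max 0 (rmem m ''s'' i) \<and>
        rmem m' ''y'' (nmem m ''n'' 0 + 1 - k) = max 0 (- rmem m ''s'' i) \<and>
        rmem m' ''e'' k = rmem m ''d'' i \<and> nmem m' ''f'' k = nmem m ''inf'' i)"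

lemma wp_sort_loop:
  assumes "nmem m ''i'' 0 = 0" "rmem m ''x'' 0 = 0" "rmem m ''y'' 0 = 0"
  shows "wp sort_loop (\<lambda>t m'. t \<le> nmem m ''n'' 0 * (nmem m ''n'' 0 * 60 + 150) + 10 \<and>
      nmem m' ''n'' = nmem m ''n'' \<and> rmem m' ''v'' = rmem m ''v'' \<and>
      nmem m' ''feasible'' = nmem m ''feasible'' \<and> sorted_data m (nmem m ''n'' 0) m') m"
proof -
  define n where "n = nmem m ''n'' 0"
  define Inv where "Inv = (\<lambda>l m'. nmem m' ''i'' 0 = l \<and>
      (\<forall>z \<in> {''n'', ''inf'', ''feasible''}. nmem m' z = nmem m z) \<and> (\<forall>z \<in> {''v'', ''s'', ''d''}. rmem m' z = rmem m z) \<and>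
      sorted_data m l m')"
  have rk: "rank (rmem m ''s'') n i \<noteq> rank (rmem m ''s'') n l" if "i < l" "l < n" for i l
    using inj_onD[OF rank_inj, of "rmem m ''s''" n i l] that by auto
  have step: "bval (NLess (nvar ''i'') (nvar ''n'')) m1 \<and>
      wp (''k'' ::= NConst 0 ;; ''j'' ::= NConst 0 ;; rank_loop ;;
       ''k'' ::= NAdd (nvar ''k'') (NConst 1) ;;
       Cond (RLess (RConst 0) (RCell ''s'' (nvar ''i'')))
         (RAssign ''x'' (nvar ''k'') (RCell ''s'' (nvar ''i'')))
         (RAssign ''x'' (nvar ''k'') (RConst 0)) ;;
       Cond (RLess (RCell ''s'' (nvar ''i'')) (RConst 0))
         (RAssign ''y'' (NSub (NAdd (nvar ''n'') (NConst 1)) (nvar ''k''))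
           (RSub (RConst 0) (RCell ''s'' (nvar ''i''))))
         (RAssign ''y'' (NSub (NAdd (nvar ''n'') (NConst 1)) (nvar ''k'')) (RConst 0)) ;;
       RAssign ''e'' (nvar ''k'') (RCell ''d'' (nvar ''i'')) ;;
       NAssign ''f'' (nvar ''k'') (NCell ''inf'' (nvar ''i'')) ;;
       ''i'' ::= NAdd (nvar ''i'') (NConst 1)) (\<lambda>t m'. t \<le> n * 60 + 140 \<and> Inv (Suc l) m') m1"
    if l: "l < n" and inv: "Inv l m1" for l m1
  proof -
    have rl: "rank (rmem m ''s'') n l < n" using rank_less[OF l] .
    \<comment> \<open>Distinct ranks give distinct cells in both numberings, so this round
      overwrites no earlier entry.\<close>
    have ri: "rank (rmem m ''s'') n i < n" "rank (rmem m ''s'') n i \<noteq> rank (rmem m ''s'') n l"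
      "n - rank (rmem m ''s'') n i \<noteq> n - rank (rmem m ''s'') n l" if "i < l" for i
      using rank_less[of i n "rmem m ''s''"] rk[OF that l] rl that l by auto
    have nn: "nmem m1 ''n'' 0 = n" "nmem m1 ''i'' 0 = l" using inv by (auto simp: Inv_def n_def)
    show ?thesis
      apply (simp add: nn l)
      apply (rule wp_mono[OF wp_rank_loop])
        apply simp
       apply simp
      using inv l rl ri
      apply (auto simp: Inv_def sorted_data_def n_def[symmetric] Let_def less_Suc_eq nn max_def)
      done
  qed
  have "wp sort_loop (\<lambda>t m'. t \<le> n * ((n * 60 + 140) + bcost (NLess (nvar ''i'') (nvar ''n'')) + 1) +
      bcost (NLess (nvar ''i'') (nvar ''n'')) + 1 \<and> Inv n m') m"
    unfolding sort_loop_def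
  proof (rule wp_Loop)
    show "Inv 0 m" using assms by (simp add: Inv_def sorted_data_def)
    show "\<not> bval (NLess (nvar ''i'') (nvar ''n'')) m1" if "Inv n m1" for m1
      using that by (simp add: Inv_def n_def)
  qed (rule step)
  then show ?thesis
    by (rule wp_mono) (auto simp: Inv_def n_def[symmetric] algebra_simps)
qed

section \<open>The dynamic program\<close>

definition stay_code :: com where
  "stay_code =
     Cond (RLess (rvar ''p'') (RConst 0)) (''c'' :::= RConst (-1))
       (''c'' :::= RAdd (rvar ''p'') (RDiv (rvar ''g'') (RAdd (RConst 1) (rvar ''v''))))"

definition cross_code :: com where
  "cross_code =
     (''b'' :::= RDiv (RAdd (rvar ''h'') (RMul (RSub (RConst 1) (rvar ''v'')) (rvar ''q'')))
                     (RAdd (RConst 1) (rvar ''v'')) ;;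
      Cond (BAnd (BNot (RLess (rvar ''q'') (RConst 0)))
             (BNot (BAnd (BNot (RLess (rvar ''c'') (RConst 0))) (BNot (RLess (rvar ''b'') (rvar ''c''))))))
        (''c'' :::= rvar ''b'') Skip)"

definition deadline_code :: com where
  "deadline_code =
     Cond (BAnd (BNot (RLess (rvar ''c'') (RConst 0)))
            (BNot (BAnd (BNot (NLess (NConst 0) (nvar ''l''))) (RLess (rvar ''w'') (rvar ''c'')))))
       Skip (''c'' :::= RConst (-1))"

definition relax_code :: com where
  "relax_code = (stay_code ;; cross_code ;; deadline_code)"

abbreviation frame_bc :: "mem \<Rightarrow> mem \<Rightarrow> bool" where
  "frame_bc m m' \<equiv> nmem m' = nmem m \<and> (\<forall>z. z \<notin> {''b'', ''c''} \<longrightarrow> rmem m' z = rmem m z)"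

lemma wp_stay_code:
  "wp stay_code (\<lambda>t m'. t \<le> 50 \<and> frame_bc m m' \<and> rmem m' ''c'' 0 =
     (if rmem m ''p'' 0 < 0 then -1 else rmem m ''p'' 0 + rmem m ''g'' 0 / (1 + rmem m ''v'' 0))) m"
  unfolding stay_code_def by simp

lemma wp_cross_code:
  "wp cross_code (\<lambda>t m'. t \<le> 100 \<and> frame_bc m m' \<and> rmem m' ''c'' 0 =
     (let b = (rmem m ''h'' 0 + (1 - rmem m ''v'' 0) * rmem m ''q'' 0) / (1 + rmem m ''v'' 0)
      in if \<not> rmem m ''q'' 0 < 0 \<and> (rmem m ''c'' 0 < 0 \<or> b < rmem m ''c'' 0) then b
         else rmem m ''c'' 0)) m"
  unfolding cross_code_def by (simp add: Let_def)

lemma wp_deadline_code: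
  "wp deadline_code (\<lambda>t m'. t \<le> 50 \<and> frame_bc m m' \<and> rmem m' ''c'' 0 =
     (if \<not> rmem m ''c'' 0 < 0 \<and> (nmem m ''l'' 0 \<noteq> 0 \<or> rmem m ''c'' 0 \<le> rmem m ''w'' 0)
      then rmem m ''c'' 0 else -1)) m"
  unfolding deadline_code_def by (auto simp: not_less)

lemma wp_relax_code:
  "wp relax_code (\<lambda>t m'. t \<le> 200 \<and> frame_bc m m' \<and>
      rmem m' ''c'' 0 = relax (rmem m ''v'' 0) (\<lambda>t. nmem m ''l'' 0 \<noteq> 0 \<or> t \<le> rmem m ''w'' 0)
        (rmem m ''p'' 0) (rmem m ''q'' 0) (rmem m ''g'' 0) (rmem m ''h'' 0)) m"
  unfolding relax_code_def relax_def Let_def wp_simps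
  apply (rule wp_mono[OF wp_stay_code])
  apply (rule wp_mono[OF wp_cross_code])
  apply (rule wp_mono[OF wp_deadline_code])
  apply (simp add: Let_def)
  done

section \<open>Filling the table row by row\<close>

definition right_code :: com where
  "right_code =
     (Cond (NLess (NConst 0) (nvar ''i''))
        (''h'' :::= RAdd (RCell ''x'' (nvar ''i'')) (RCell ''y'' (nvar ''j'')) ;;
         ''p'' :::= RCell ''A'' (nvar ''j'') ;; ''q'' :::= RCell ''B'' (nvar ''j'') ;;
         ''g'' :::= RSub (RCell ''x'' (nvar ''i'')) (RCell ''x'' (NSub (nvar ''i'') (NConst 1))) ;;
         ''w'' :::= RCell ''e'' (nvar ''i'') ;; ''l'' ::= NCell ''f'' (nvar ''i'') ;; relax_code)
        (Cond (NLess (NConst 0) (nvar ''j'')) (''c'' :::= RConst (-1)) (''c'' :::= RConst 0)) ;;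
      RAssign ''A'' (nvar ''j'') (rvar ''c''))"

text \<open>Entry \<open>j\<close> of \<open>''B''\<close> depends on column \<open>j - 1\<close> of
  the current row, whereas \<open>right_code\<close> reads column \<open>j\<close> of the previous
  one. So one row per side suffices, provided \<open>right_code\<close> runs before
  \<open>''B''\<close> is overwritten at \<open>j\<close>. Deadlines are stored from left to right,
  hence the index \<open>n + 1 - j\<close>.\<close>

definition left_code :: com where
  "left_code =
     (Cond (NLess (NConst 0) (nvar ''j''))
        (''h'' :::= RAdd (RCell ''y'' (nvar ''j'')) (RCell ''x'' (nvar ''i'')) ;;
         ''p'' :::= RCell ''B'' (NSub (nvar ''j'') (NConst 1)) ;;
         ''q'' :::= RCell ''A'' (NSub (nvar ''j'') (NConst 1)) ;;
         ''g'' :::= RSub (RCell ''y'' (nvar ''j'')) (RCell ''y'' (NSub (nvar ''j'') (NConst 1))) ;;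
         ''w'' :::= RCell ''e'' (NSub (NAdd (nvar ''n'') (NConst 1)) (nvar ''j'')) ;;
         ''l'' ::= NCell ''f'' (NSub (NAdd (nvar ''n'') (NConst 1)) (nvar ''j'')) ;; relax_code)
        (Cond (NLess (NConst 0) (nvar ''i'')) (''c'' :::= RConst (-1)) (''c'' :::= RConst 0)) ;;
      RAssign ''B'' (nvar ''j'') (rvar ''c''))"

abbreviation same_data :: "mem \<Rightarrow> mem \<Rightarrow> bool" where
  "same_data m m' \<equiv> (\<forall>z\<in>{''n'', ''f'', ''feasible''}. nmem m' z = nmem m z) \<and>
     (\<forall>z\<in>{''v'', ''x'', ''y'', ''e''}. rmem m' z = rmem m z)"

definition in_time :: "mem \<Rightarrow> nat \<Rightarrow> real \<Rightarrow> bool" where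
  "in_time m k t \<longleftrightarrow> nmem m ''f'' k \<noteq> 0 \<or> t \<le> rmem m ''e'' k"

lemma wp_right_code:
  assumes "nmem m ''i'' 0 = i" "nmem m ''j'' 0 = j"
  shows "wp right_code (\<lambda>t m'. t \<le> 300 \<and> same_data m m' \<and> nmem m' ''i'' 0 = i \<and> nmem m' ''j'' 0 = j \<and>
     rmem m' ''B'' = rmem m ''B'' \<and> rmem m' ''A'' = (rmem m ''A'')(j :=
       if 0 < i then relax (rmem m ''v'' 0) (in_time m i) (rmem m ''A'' j) (rmem m ''B'' j)
           (rmem m ''x'' i - rmem m ''x'' (i - 1)) (rmem m ''x'' i + rmem m ''y'' j)
       else if 0 < j then -1 else 0)) m"
proof (cases "0 < i")
  case True
  show ?thesis unfolding right_code_def wp_simps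
    apply (simp add: assms True)
    apply (rule wp_mono[OF wp_relax_code])
    apply (simp add: assms in_time_def[abs_def])
    done
next
  case False
  then show ?thesis unfolding right_code_def by (simp add: assms)
qed

lemma wp_left_code:
  assumes "nmem m ''i'' 0 = i" "nmem m ''j'' 0 = j"
  shows "wp left_code (\<lambda>t m'. t \<le> 300 \<and> same_data m m' \<and> nmem m' ''i'' 0 = i \<and> nmem m' ''j'' 0 = j \<and>
     rmem m' ''A'' = rmem m ''A'' \<and> rmem m' ''B'' = (rmem m ''B'')(j :=
       if 0 < j then relax (rmem m ''v'' 0) (in_time m (nmem m ''n'' 0 + 1 - j))
           (rmem m ''B'' (j - 1)) (rmem m ''A'' (j - 1))
           (rmem m ''y'' j - rmem m ''y'' (j - 1)) (rmem m ''y'' j + rmem m ''x'' i)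
       else if 0 < i then -1 else 0)) m"
proof (cases "0 < j")
  case True
  show ?thesis unfolding left_code_def wp_simps
    apply (simp add: assms True)
    apply (rule wp_mono[OF wp_relax_code])
    apply (simp add: assms in_time_def[abs_def])
    done
next
  case False
  then show ?thesis unfolding left_code_def by (simp add: assms)
qed

definition right_arrival :: "mem \<Rightarrow> nat \<Rightarrow> nat \<Rightarrow> real" where
  "right_arrival m i j = arrive (rmem m ''v'' 0) (rmem m ''x'') (rmem m ''y'')
     (in_time m) (\<lambda>k. in_time m (nmem m ''n'' 0 + 1 - k)) i j"

definition left_arrival :: "mem \<Rightarrow> nat \<Rightarrow> nat \<Rightarrow> real" where
  "left_arrival m i j = arrive (rmem m ''v'' 0) (rmem m ''y'') (rmem m ''x'')
     (\<lambda>k. in_time m (nmem m ''n'' 0 + 1 - k)) (in_time m) j i"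

lemma right_arrival_eq:
  "right_arrival m i j =
     (if 0 < i then relax (rmem m ''v'' 0) (in_time m i) (right_arrival m (i - 1) j) (left_arrival m (i - 1) j)
           (rmem m ''x'' i - rmem m ''x'' (i - 1)) (rmem m ''x'' i + rmem m ''y'' j)
      else if 0 < j then -1 else 0)"
  by (cases i) (auto simp: right_arrival_def left_arrival_def)

lemma left_arrival_eq:
  "left_arrival m i j =
     (if 0 < j then relax (rmem m ''v'' 0) (in_time m (nmem m ''n'' 0 + 1 - j))
           (left_arrival m i (j - 1)) (right_arrival m i (j - 1))
           (rmem m ''y'' j - rmem m ''y'' (j - 1)) (rmem m ''y'' j + rmem m ''x'' i)
      else if 0 < i then -1 else 0)"
  by (cases j) (auto simp: right_arrival_def left_arrival_def)

text \<open>
  Up to column \<open>j\<close> the arrays hold row \<open>i\<close> of the table, from then on still the previous row.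
\<close>

definition row_inv :: "mem \<Rightarrow> nat \<Rightarrow> nat \<Rightarrow> mem \<Rightarrow> bool" where
  "row_inv m i j m' \<longleftrightarrow> same_data m m' \<and> nmem m' ''i'' 0 = i \<and> nmem m' ''j'' 0 = j \<and>
     (\<forall>k\<le>nmem m ''n'' 0.
        (k < j \<longrightarrow> rmem m' ''A'' k = right_arrival m i k \<and> rmem m' ''B'' k = left_arrival m i k) \<and>
        (j \<le> k \<longrightarrow> 0 < i \<longrightarrow>
           rmem m' ''A'' k = right_arrival m (i - 1) k \<and> rmem m' ''B'' k = left_arrival m (i - 1) k))"

definition row_loop :: com where
  "row_loop = Loop (NLess (nvar ''j'') (NAdd (nvar ''n'') (NConst 1)))
     (right_code ;; left_code ;; ''j'' ::= NAdd (nvar ''j'') (NConst 1))"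

lemma row_step:
  assumes inv: "row_inv m i j m1" and j: "j \<le> nmem m ''n'' 0"
  shows "wp (right_code ;; left_code ;; ''j'' ::= NAdd (nvar ''j'') (NConst 1))
    (\<lambda>t m'. t \<le> 700 \<and> row_inv m i (Suc j) m') m1"
proof -
  have eqs: "nmem m1 ''i'' 0 = i" "nmem m1 ''j'' 0 = j" and sd: "same_data m m1"
    using inv by (auto simp: row_inv_def)
  have old: "0 < i \<Longrightarrow> rmem m1 ''A'' j = right_arrival m (i - 1) j"
      "0 < i \<Longrightarrow> rmem m1 ''B'' j = left_arrival m (i - 1) j"
      "0 < j \<Longrightarrow> rmem m1 ''A'' (j - 1) = right_arrival m i (j - 1)"
      "0 < j \<Longrightarrow> rmem m1 ''B'' (j - 1) = left_arrival m i (j - 1)"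
    using inv j by (auto simp: row_inv_def)
  have it: "in_time m' = in_time m" if "same_data m m'" for m'
    using that by (simp add: in_time_def fun_eq_iff)
  show ?thesis
    unfolding wp_simps(4)
  proof (rule wp_mono[OF wp_right_code[OF eqs]], elim conjE)
    fix t2 :: nat and m2 :: mem
    assume t2: "t2 \<le> 300" and sd2: "\<forall>z\<in>{''n'', ''f'', ''feasible''}. nmem m2 z = nmem m1 z"
      "\<forall>z\<in>{''v'', ''x'', ''y'', ''e''}. rmem m2 z = rmem m1 z"
      and ij: "nmem m2 ''i'' 0 = i" "nmem m2 ''j'' 0 = j"
      and B: "rmem m2 ''B'' = rmem m1 ''B''"
      and A: "rmem m2 ''A'' = (rmem m1 ''A'')(j :=
       if 0 < i then relax (rmem m1 ''v'' 0) (in_time m1 i) (rmem m1 ''A'' j) (rmem m1 ''B'' j)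
           (rmem m1 ''x'' i - rmem m1 ''x'' (i - 1)) (rmem m1 ''x'' i + rmem m1 ''y'' j)
       else if 0 < j then -1 else 0)"
    have sd': "same_data m m2" using sd sd2 by simp
    have A': "rmem m2 ''A'' = (rmem m1 ''A'')(j := right_arrival m i j)"
      unfolding A right_arrival_eq[of m i j] using sd by (simp add: old it[OF sd])
    show "wp left_code (\<lambda>k. wp (''j'' ::= NAdd (nvar ''j'') (NConst 1))
        (\<lambda>k2 m'. t2 + (k + k2) \<le> 700 \<and> row_inv m i (Suc j) m')) m2"
    proof (rule wp_mono[OF wp_left_code[OF ij]], elim conjE)
      fix t3 :: nat and m3 :: mem
      assume t3: "t3 \<le> 300" and sd3: "\<forall>z\<in>{''n'', ''f'', ''feasible''}. nmem m3 z = nmem m2 z"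
        "\<forall>z\<in>{''v'', ''x'', ''y'', ''e''}. rmem m3 z = rmem m2 z"
        and ij3: "nmem m3 ''i'' 0 = i" "nmem m3 ''j'' 0 = j"
        and A3: "rmem m3 ''A'' = rmem m2 ''A''"
        and B3: "rmem m3 ''B'' = (rmem m2 ''B'')(j :=
       if 0 < j then relax (rmem m2 ''v'' 0) (in_time m2 (nmem m2 ''n'' 0 + 1 - j))
           (rmem m2 ''B'' (j - 1)) (rmem m2 ''A'' (j - 1))
           (rmem m2 ''y'' j - rmem m2 ''y'' (j - 1)) (rmem m2 ''y'' j + rmem m2 ''x'' i)
       else if 0 < i then -1 else 0)"
      have sd3': "same_data m m3" using sd' sd3 by simp
      have B3': "rmem m3 ''B'' = (rmem m1 ''B'')(j := left_arrival m i j)"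
        unfolding B3 left_arrival_eq[of m i j] A' B using sd' old(3,4) it[OF sd'] by (cases j) auto
      show "wp (''j'' ::= NAdd (nvar ''j'') (NConst 1))
        (\<lambda>k2 m'. t2 + (t3 + k2) \<le> 700 \<and> row_inv m i (Suc j) m') m3"
        using t2 t3 sd3' ij3 inv by (simp add: row_inv_def A3 A' B3' less_Suc_eq)
    qed
  qed
qed

lemma wp_row_loop:
  assumes "row_inv m i 0 m1"
  shows "wp row_loop (\<lambda>t m'. t \<le> (nmem m ''n'' 0 + 1) * 710 + 20 \<and> row_inv m i (nmem m ''n'' 0 + 1) m') m1"
  unfolding row_loop_def
proof (rule wp_mono[OF wp_Loop[where N = "nmem m ''n'' 0 + 1" and K = 700 and Inv = "row_inv m i"]])
  fix j m2 assume j: "j < nmem m ''n'' 0 + 1" and inv: "row_inv m i j m2"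
  have "bval (NLess (nvar ''j'') (NAdd (nvar ''n'') (NConst 1))) m2"
    using j inv by (simp add: row_inv_def)
  then show "bval (NLess (nvar ''j'') (NAdd (nvar ''n'') (NConst 1))) m2 \<and>
      wp (right_code ;; left_code ;; ''j'' ::= NAdd (nvar ''j'') (NConst 1))
        (\<lambda>t m'. t \<le> 700 \<and> row_inv m i (Suc j) m') m2"
    using row_step[OF inv] j by simp
qed (use assms in \<open>auto simp: row_inv_def\<close>)

definition table_loop :: com where
  "table_loop = Loop (NLess (nvar ''i'') (NAdd (nvar ''n'') (NConst 1)))
     (''j'' ::= NConst 0 ;; row_loop ;; ''i'' ::= NAdd (nvar ''i'') (NConst 1))"

lemma wp_table_loop:
  assumes "nmem m ''i'' 0 = 0"
  shows "wp table_loop (\<lambda>t m'. t \<le> (nmem m ''n'' 0 + 1) * ((nmem m ''n'' 0 + 1) * 710 + 50) + 20 \<and>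
     same_data m m' \<and> rmem m' ''A'' (nmem m ''n'' 0) = right_arrival m (nmem m ''n'' 0) (nmem m ''n'' 0) \<and>
     rmem m' ''B'' (nmem m ''n'' 0) = left_arrival m (nmem m ''n'' 0) (nmem m ''n'' 0)) m"
proof -
  define n where "n = nmem m ''n'' 0"
  \<comment> \<open>A finished row leaves \<open>''j''\<close> at \<open>n + 1\<close>; the
    invariant speaks of the memory with \<open>''j''\<close> reset, as the body does first.\<close>
  define Inv where "Inv = (\<lambda>i m'. row_inv m i 0 (m'\<lparr>nmem := (nmem m')(''j'' := (nmem m' ''j'')(0 := 0))\<rparr>))"
  have step: "bval (NLess (nvar ''i'') (NAdd (nvar ''n'') (NConst 1))) m1 \<and>
      wp (''j'' ::= NConst 0 ;; row_loop ;; ''i'' ::= NAdd (nvar ''i'') (NConst 1))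
        (\<lambda>t m'. t \<le> (n + 1) * 710 + 40 \<and> Inv (Suc i) m') m1"
    if "i < n + 1" "Inv i m1" for i m1
  proof
    show "bval (NLess (nvar ''i'') (NAdd (nvar ''n'') (NConst 1))) m1"
      using that by (simp add: Inv_def row_inv_def n_def)
    show "wp (''j'' ::= NConst 0 ;; row_loop ;; ''i'' ::= NAdd (nvar ''i'') (NConst 1))
        (\<lambda>t m'. t \<le> (n + 1) * 710 + 40 \<and> Inv (Suc i) m') m1"
      apply simp
      apply (rule wp_mono[OF wp_row_loop])
      using that(2) apply (simp add: Inv_def)
      apply (auto simp: Inv_def row_inv_def n_def)
      done
  qed
  have "wp table_loop (\<lambda>t m'. t \<le> (n + 1) * ((n + 1) * 710 + 40 +
      bcost (NLess (nvar ''i'') (NAdd (nvar ''n'') (NConst 1))) + 1) +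
      bcost (NLess (nvar ''i'') (NAdd (nvar ''n'') (NConst 1))) + 1 \<and> Inv (n + 1) m') m"
    unfolding table_loop_def
  proof (rule wp_Loop)
    show "Inv 0 m" using assms by (simp add: Inv_def row_inv_def)
    show "\<not> bval (NLess (nvar ''i'') (NAdd (nvar ''n'') (NConst 1))) m1" if "Inv (n + 1) m1" for m1
      using that by (simp add: Inv_def row_inv_def n_def)
  qed (rule step)
  then show ?thesis
    \<comment> \<open>At exit \<open>''i''\<close> is \<open>n + 1\<close>, and the previous row
      that the arrays hold is row \<open>n\<close>.\<close>
    by (rule wp_mono) (auto simp: Inv_def row_inv_def n_def[symmetric] algebra_simps)
qed

text \<open>The flag \<open>''feasible''\<close> also records whether \<open>''makespan''\<close>
  already holds a candidate, so the left candidate is taken unconditionally if the right one is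
  missing.\<close>

definition answer_code :: com where
  "answer_code =
     (Cond (RLess (RCell ''A'' (nvar ''n'')) (RConst 0)) Skip
        (''g'' :::= RSub (RCell ''x'' (nvar ''n'')) (RMul (rvar ''v'') (RCell ''A'' (nvar ''n''))) ;;
         Cond (RLess (rvar ''g'') (RConst 0)) (''g'' :::= RSub (RConst 0) (rvar ''g'')) Skip ;;
         ''makespan'' :::= RAdd (RCell ''A'' (nvar ''n'')) (rvar ''g'') ;;
         ''feasible'' ::= NConst 1) ;;
      Cond (RLess (RCell ''B'' (nvar ''n'')) (RConst 0)) Skip
        (''g'' :::= RSub (RCell ''y'' (nvar ''n'')) (RMul (rvar ''v'') (RCell ''B'' (nvar ''n''))) ;;
         Cond (RLess (rvar ''g'') (RConst 0)) (''g'' :::= RSub (RConst 0) (rvar ''g'')) Skip ;;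
         ''c'' :::= RAdd (RCell ''B'' (nvar ''n'')) (rvar ''g'') ;;
         Cond (BAnd (NLess (NConst 0) (nvar ''feasible'')) (BNot (RLess (rvar ''c'') (rvar ''makespan'')))) Skip
           (''makespan'' :::= rvar ''c'' ;; ''feasible'' ::= NConst 1)))"

lemma wp_answer_code:
  assumes "nmem m ''feasible'' 0 = 0"
  shows "wp answer_code (\<lambda>t m'. t \<le> 200 \<and> result m' =
    best_return (rmem m ''v'' 0) (rmem m ''A'' (nmem m ''n'' 0)) (rmem m ''x'' (nmem m ''n'' 0))
      (rmem m ''B'' (nmem m ''n'' 0)) (rmem m ''y'' (nmem m ''n'' 0))) m"
proof -
  define a b X Y v where d: "a = rmem m ''A'' (nmem m ''n'' 0)" "b = rmem m ''B'' (nmem m ''n'' 0)"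
    "X = rmem m ''x'' (nmem m ''n'' 0)" "Y = rmem m ''y'' (nmem m ''n'' 0)" "v = rmem m ''v'' 0"
  show ?thesis unfolding d(1-5)[symmetric]
    by (cases "a < 0"; cases "b < 0"; cases "X - v * a < 0"; cases "Y - v * b < 0")
      (use assms in \<open>simp_all add: answer_code_def result_def best_return_def abs_if min_def not_less d(1-5)[symmetric]\<close>)
qed

section \<open>Correctness and running time of the whole program\<close>

definition cltsp_program :: com where
  "cltsp_program = (sort_loop ;; ''i'' ::= NConst 0 ;; table_loop ;; answer_code)"

lemma sorted_data_cltsp:
  assumes I: "plain_cltsp I" and as: "distinct as" "set as = clients I"
    and sd: "sorted_data (input_mem I as) (length as) m"
  shows "\<exists>q. sorted_cltsp I q (length as) (rmem m ''x'') (rmem m ''y'')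
     (in_time m) (\<lambda>k. in_time m (length as + 1 - k))"
proof -
  interpret plain_cltsp I by (rule I)
  define n s where "n = length as" and "s = list_array (start I) as"
  \<comment> \<open>Inverting the rank permutation lists the clients from left to right; ranks start
    at 0, clients \<open>q k\<close> at 1.\<close>
  define p where "p = inv_into {..<n} (rank s n)"
  define q where "q k = as ! p (k - 1)" for k
  have p: "bij_betw p {..<n} {..<n}" unfolding p_def by (intro bij_betw_inv_into rank_bij)
  have rp: "rank s n (p k) = k" "p k < n" if "k < n" for k
    using bij_betw_inv_into_right[OF rank_bij[of s n]] bij_betw_apply[OF p, of k] that by (auto simp: p_def)
  have cells: "rmem m ''x'' (Suc k) = max 0 (start I (q (Suc k)))"
      "rmem m ''y'' (n - k) = max 0 (- start I (q (Suc k)))"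
      "rmem m ''e'' (Suc k) = real_of_ereal (deadline I (q (Suc k)))"
      "nmem m ''f'' (Suc k) = (if deadline I (q (Suc k)) = \<infinity> then 1 else 0)"
    if "k < n" for k
    using sd rp[OF that]
    by (auto simp: sorted_data_def input_mem_def list_array_def s_def[symmetric] n_def[symmetric] q_def
        dest!: spec[of _ "p k"]) (auto simp: s_def list_array_def n_def)
  have "bij_betw (\<lambda>k. k - 1) {1..n} {..<n}"
    by (rule bij_betw_byWitness[where f' = Suc]) auto
  moreover have "bij_betw ((!) as) {..<n} (clients I)"
    using bij_betw_nth[OF as(1)] as(2) by (simp add: n_def)
  ultimately have "bij_betw ((!) as \<circ> (p \<circ> (\<lambda>k. k - 1))) {1..n} (clients I)"
    using p by (intro bij_betw_trans)
  then have q: "bij_betw q {1..n} (clients I)"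
    by (simp add: q_def[abs_def] comp_def)
  \<comment> \<open>A nonnegative deadline is not minus infinity, so \<open>real_of_ereal\<close>
    loses only \<infinity>, which the mark in \<open>''f''\<close> restores.\<close>
  have it: "in_time m k t \<longleftrightarrow> ereal t \<le> deadline I (q k)" if "1 \<le> k" "k \<le> n" for k t
  proof -
    have "0 \<le> deadline I (q k)"
      using bij_betw_apply[OF q, of k] that by (intro deadline_nonneg) simp
    then show ?thesis using cells(3,4)[of "k - 1"] that
      by (cases "deadline I (q k)") (auto simp: in_time_def)
  qed
  have "sorted_cltsp I q n (rmem m ''x'') (rmem m ''y'') (in_time m) (\<lambda>k. in_time m (n + 1 - k))"
  proof
    fix i j :: nat assume ij: "1 \<le> i" "i \<le> j" "j \<le> n"
    have "\<not> precedes s (p (j - 1)) (p (i - 1))"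
      using rank_strict_mono[of s "p (j - 1)" "p (i - 1)" n] rp[of "i - 1"] rp[of "j - 1"] ij by auto
    then show "start I (q i) \<le> start I (q j)"
      using rp[of "i - 1"] rp[of "j - 1"] ij
      by (auto simp: precedes_def s_def list_array_def n_def q_def)
  next
    fix k assume k: "1 \<le> k" "k \<le> n"
    then show "rmem m ''x'' k = max 0 (start I (q k))" using cells(1)[of "k - 1"] by simp
    have "n - (n - k) = k" using k by simp
    then show "rmem m ''y'' k = max 0 (- start I (q (n + 1 - k)))"
      using cells(2)[of "n - k"] k by (simp add: Suc_diff_le)
  next
    fix k and t :: real assume k: "1 \<le> k" "k \<le> n"
    then show "in_time m k t \<longleftrightarrow> ereal t \<le> deadline I (q k)" by (rule it)
    show "in_time m (n + 1 - k) t \<longleftrightarrow> ereal t \<le> deadline I (q (n + 1 - k))"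
      using k by (intro it) auto
  qed (use q sd in \<open>auto simp: sorted_data_def\<close>)
  then show ?thesis unfolding n_def by blast
qed

lemma wp_cltsp_program:
  assumes I: "plain_cltsp I" and as: "distinct as" "set as = clients I"
  shows "wp cltsp_program (\<lambda>t m'. t \<le> 2000 * (length as + 1)\<^sup>2 \<and> correct_answer I (result m')) (input_mem I as)"
proof -
  define n m where "n = length as" and "m = input_mem I as"
  have m: "nmem m ''n'' 0 = n" "nmem m ''i'' 0 = 0" "rmem m ''x'' 0 = 0" "rmem m ''y'' 0 = 0"
    "nmem m ''feasible'' 0 = 0" "rmem m ''v'' 0 = speed I"
    by (simp_all add: m_def n_def input_mem_def)
  have "wp cltsp_program (\<lambda>t m'. t \<le> 2000 * (n + 1)\<^sup>2 \<and> correct_answer I (result m')) m"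
    unfolding cltsp_program_def wp_simps
  proof (rule wp_mono[OF wp_sort_loop[OF m(2-4)]], unfold m(1), elim conjE)
    fix t1 :: nat and m1 :: mem
    assume t1: "t1 \<le> n * (n * 60 + 150) + 10" and n1: "nmem m1 ''n'' = nmem m ''n''"
      and v1: "rmem m1 ''v'' = rmem m ''v''" and f1: "nmem m1 ''feasible'' = nmem m ''feasible''"
      and sd: "sorted_data m n m1"
    define m2 where "m2 = m1\<lparr>nmem := (nmem m1)(''i'' := (nmem m1 ''i'')(nval (NConst 0) m1 := nval (NConst 0) m1))\<rparr>"
    have m2: "nmem m2 ''n'' 0 = n" "nmem m2 ''i'' 0 = 0" "nmem m2 ''feasible'' 0 = 0" "rmem m2 = rmem m1"
      "nmem m2 ''f'' = nmem m1 ''f''" "rmem m2 ''v'' 0 = speed I"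
      using n1 f1 v1 m by (simp_all add: m2_def)
    have "sorted_data m n m2" using sd by (simp add: sorted_data_def m2_def)
    then obtain q where "sorted_cltsp I q n (rmem m2 ''x'') (rmem m2 ''y'')
        (in_time m2) (\<lambda>k. in_time m2 (n + 1 - k))"
      using sorted_data_cltsp[OF I as, of m2] by (auto simp: n_def m_def)
    then interpret sorted_cltsp I q n "rmem m2 ''x''" "rmem m2 ''y''" "in_time m2" "\<lambda>k. in_time m2 (n + 1 - k)" .
    show "wp table_loop (\<lambda>k2. wp answer_code (\<lambda>k2a m'.
        t1 + (ncost (NConst 0) + ncost (NConst 0) + 1 + (k2 + k2a)) \<le> 2000 * (n + 1)\<^sup>2 \<and>
        correct_answer I (result m')))
       (m1\<lparr>nmem := (nmem m1)(''i'' := (nmem m1 ''i'')(nval (NConst 0) m1 := nval (NConst 0) m1))\<rparr>)"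
      unfolding m2_def[symmetric]
    proof (rule wp_mono[OF wp_table_loop[OF m2(2)]], unfold m2(1), elim conjE)
      fix t3 :: nat and m3 :: mem
      assume t3: "t3 \<le> (n + 1) * ((n + 1) * 710 + 50) + 20"
        and sd3: "\<forall>z\<in>{''n'', ''f'', ''feasible''}. nmem m3 z = nmem m2 z"
          "\<forall>z\<in>{''v'', ''x'', ''y'', ''e''}. rmem m3 z = rmem m2 z"
        and A: "rmem m3 ''A'' n = right_arrival m2 n n" and B: "rmem m3 ''B'' n = left_arrival m2 n n"
      have f3: "nmem m3 ''feasible'' 0 = 0" using sd3 m2 by simp
      \<comment> \<open>The summands are sorting, the assignment to \<open>''i''\<close> (3 units),
        the table and the answer (200 units).\<close>
      have "n * (n * 60 + 150) + 10 + 3 + ((n + 1) * ((n + 1) * 710 + 50) + 20 + 200) \<le> 2000 * (n + 1)\<^sup>2"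
        by (simp add: power2_eq_square algebra_simps)
      then have "t1 + (ncost (NConst 0) + ncost (NConst 0) + 1 + (t3 + t4)) \<le> 2000 * (n + 1)\<^sup>2" if "t4 \<le> 200" for t4
        using t1 t3 that by simp
      moreover have "correct_answer I (best_return (rmem m3 ''v'' 0)
          (rmem m3 ''A'' (nmem m3 ''n'' 0)) (rmem m3 ''x'' (nmem m3 ''n'' 0))
          (rmem m3 ''B'' (nmem m3 ''n'' 0)) (rmem m3 ''y'' (nmem m3 ''n'' 0)))"
        using best_return_correct sd3 m2(1,6) by (simp add: A B right_arrival_def left_arrival_def)
      ultimately show "wp answer_code (\<lambda>k2a m'.
          t1 + (ncost (NConst 0) + ncost (NConst 0) + 1 + (t3 + k2a)) \<le> 2000 * (n + 1)\<^sup>2 \<and>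
          correct_answer I (result m')) m3"
        by (intro wp_mono[OF wp_answer_code[OF f3]]) auto
    qed
  qed
  then show ?thesis by (simp add: n_def m_def)
qed

theorem theorem4:
  "\<exists>(P :: com) (T :: nat \<Rightarrow> nat).
     (\<lambda>n. real (T n)) \<in> O(\<lambda>n. real n ^ 2) \<and>
     solves_within P
       (\<lambda>I. (\<forall>a\<in>clients I. proctime I a = 0) \<and>
            (\<forall>a\<in>clients I. release I a = 0) \<and>
            0 < speed I \<and> speed I < 1) T"
proof (intro exI conjI)
  show "(\<lambda>n. real (2000 * (n + 1)\<^sup>2)) \<in> O(\<lambda>n. real n ^ 2)"
  \<comment> \<open>For \<open>n \<ge> 1\<close>, \<open>n + 1 \<le> 2 * n\<close> turns the factor
    2000 into 8000.\<close>
  proof (rule bigoI[where c = 8000], rule eventually_mono[OF eventually_ge_at_top[of 1]])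
    fix n :: nat assume "1 \<le> n"
    then have "(real n + 1)\<^sup>2 \<le> (2 * real n)\<^sup>2" by (intro power_mono) auto
    then show "norm (real (2000 * (n + 1)\<^sup>2)) \<le> 8000 * norm (real n ^ 2)"
      by (simp add: power_mult_distrib add.commute)
  qed
  show "solves_within cltsp_program
       (\<lambda>I. (\<forall>a\<in>clients I. proctime I a = 0) \<and>
            (\<forall>a\<in>clients I. release I a = 0) \<and>
            0 < speed I \<and> speed I < 1) (\<lambda>n. 2000 * (n + 1)\<^sup>2)"
    unfolding solves_within_def
  proof (intro allI impI, elim conjE)
    fix I :: "nat cltsp" and as
    assume "cltsp_instance I" "\<forall>a\<in>clients I. proctime I a = 0" "\<forall>a\<in>clients I. release I a = 0"
      "speed I < 1" and as: "distinct as" "set as = clients I"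
    then have "plain_cltsp I" by unfold_locales auto
    moreover have "card (clients I) = length as" using as distinct_card by metis
    ultimately show "\<exists>k m. exec cltsp_program (input_mem I as) k m \<and> k \<le> 2000 * (card (clients I) + 1)\<^sup>2 \<and>
        correct_answer I (result m)"
      using wp_cltsp_program[of I as] as by (simp add: wp_def)
  qed
qed

end
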